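(* Let $\sigma=(\sigma(x))_{x\in\mathsf{SG}}$ be an i.i.d. sandpile on the doubly-infinite Sierpiński gasket graph $\mathsf{SG}$, i.e. a family of i.i.d. random variables with values in $\mathbb{N}_0=\{0,1,2,\dots\}$, such that $\mathbb{E}[\sigma(o)]\ge 3$, where $o=(0,0)$. If $0<\mathrm{Var}[\sigma(o)]<\infty$, then almost surely $\sigma$ does not stabilize; that is, with probability one $\sigma$ is not stabilizable.
   Context: **The graph $\mathsf{SG}$.** In $\mathbb{R}^2$ let $V_0=\{(0,0),(1,0),(1/2,\sqrt3/2)\}$ and let $E_0$ be the set of the three (undirected) edges joining pairs of distinct points of $V_0$. For $n\ge 0$ define recursively $$V_{n+1}=V_n\cup\big((2^n,0)+V_n\big)\cup\big((2^{n-1},2^{n-1}\sqrt3)+V_n\big),\qquad E_{n+1}=E_n\cup\big((2^n,0)+E_n\big)\cup\big((2^{n-1},2^{n-1}\sqrt3)+E_n\big),$$ where translations act on edges through their endpoints. Let $V_n',E_n'$ be the reflections of $V_n,E_n$ under $(x,y)\mapsto(-x,y)$. Let $\mathsf{SG}_n$ be the finite graph with vertex set $V_n\cup V_n'$ and edge set $E_n\cup E_n'$, and let $\mathsf{SG}=\bigcup_n\mathsf{SG}_n$ (union of vertex sets and of edge sets). Every vertex of $\mathsf{SG}$ has degree $4$. "$x\in\mathsf{SG}$" means that $x$ is a vertex of $\mathsf{SG}$. **Sandpiles and stabilization.** A sandpile is a function $\sigma:\mathsf{SG}\to\mathbb{N}_0$. A vertex $x$ is stable if $\sigma(x)\le 3$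 and unstable if $\sigma(x)\ge 4$; an unstable vertex topples by sending one chip to each of its four neighbours. For each $n$, stabilize $\sigma$ on $\mathsf{SG}_n$: topple unstable vertices of $\mathsf{SG}_n$ until all of them are stable, where chips sent to vertices outside $\mathsf{SG}_n$ (the outer boundary, acting as sink) are collected there and vertices outside $\mathsf{SG}_n$ never topple. This takes finitely many topplings and, by the Abelian property, the result and the number of topplings at each vertex do not depend on the order of topplings. Let $u_n(x)$ (the odometer function) be the total mass (number of chips) emitted from $x$ during the stabilization on $\mathsf{SG}_n$, with $u_n(x)=0$ for $x\notin\mathsf{SG}_n$. The functions $u_n$ are nondecreasing in $n$, so $u^\infty(x)=\lim_{n\to\infty}u_n(x)\in[0,\infty]$ exists. The sandpile $\sigma$ is called stabilizable (one says it stabilizes) if $u^\infty(x)<\infty$ for every $x\in\mathsf{SG}$; it is not stabilizable if $u^\infty(x)=\infty$ for some $x\in\mathsf{SG}$. *)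

theory Defs
  imports "HOL-Probability.Probability"
begin

type_synonym point = "real \<times> real"

(* The translation (2^(n-1), 2^(n-1) * sqrt 3) is written with 2^n / 2, so that n = 0 gives 1/2. *)
fun V :: "nat \<Rightarrow> point set" where
  "V 0 = {(0, 0), (1, 0), (1 / 2, sqrt 3 / 2)}"
| "V (Suc n) = V n \<union> (+) (2 ^ n, 0) ` V n \<union> (+) (2 ^ n / 2, 2 ^ n / 2 * sqrt 3) ` V n"

(* An undirected edge is the set of its two endpoints; translations act by image. *)
fun E :: "nat \<Rightarrow> point set set" where
  "E 0 = {{x, y} | x y. x \<in> V 0 \<and> y \<in> V 0 \<and> x \<noteq> y}"
| "E (Suc n) = E n \<union> (`) ((+) (2 ^ n, 0)) ` E n
                   \<union> (`) ((+) (2 ^ n / 2, 2 ^ n / 2 * sqrt 3)) ` E n"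

definition reflect :: "point \<Rightarrow> point" where
  "reflect p = (- fst p, snd p)"

definition SG_level :: "nat \<Rightarrow> point set" where
  "SG_level n = V n \<union> reflect ` V n"

definition SG_level_edges :: "nat \<Rightarrow> point set set" where
  "SG_level_edges n = E n \<union> (`) reflect ` E n"

definition SG :: "point set" where
  "SG = (\<Union>n. SG_level n)"

definition SG_edges :: "point set set" where
  "SG_edges = (\<Union>n. SG_level_edges n)"

(* Only the values on SG matter: topplings happen in SG and send chips along edges of SG. *)
type_synonym sandpile = "point \<Rightarrow> nat"

definition unstable :: "sandpile \<Rightarrow> point \<Rightarrow> bool" where
  "unstable \<sigma> x \<longleftrightarrow> \<sigma> x \<ge> 4"

(* The subtraction is on nat; topple is only applied at unstable vertices. *)
definition topple :: "point \<Rightarrow> sandpile \<Rightarrow> sandpile" where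
  "topple x \<sigma> = (\<lambda>y. if y = x then \<sigma> y - 4
                      else if {x, y} \<in> SG_edges then \<sigma> y + 1 else \<sigma> y)"

fun legal_topplings :: "nat \<Rightarrow> sandpile \<Rightarrow> point list \<Rightarrow> bool" where
  "legal_topplings n \<sigma> [] \<longleftrightarrow> True"
| "legal_topplings n \<sigma> (x # xs) \<longleftrightarrow>
     x \<in> SG_level n \<and> unstable \<sigma> x \<and> legal_topplings n (topple x \<sigma>) xs"

(* The neighbours outside SG_level n act as the sink: they collect chips and never topple. *)
definition stabilizing_topplings :: "nat \<Rightarrow> sandpile \<Rightarrow> point list \<Rightarrow> bool" where
  "stabilizing_topplings n \<sigma> xs \<longleftrightarrow>
     legal_topplings n \<sigma> xs \<and> (\<forall>x\<in>SG_level n. \<not> unstable (fold topple xs \<sigma>) x)"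

(* The odometer counts emitted chips, i.e. four per toppling. The description is proper:
   stabilizing sequences exist, and all of them topple each vertex equally often. *)
definition odometer :: "nat \<Rightarrow> sandpile \<Rightarrow> point \<Rightarrow> nat" where
  "odometer n \<sigma> = (THE u. \<exists>xs. stabilizing_topplings n \<sigma> xs \<and> u = (\<lambda>x. 4 * count_list xs x))"

definition odometer_limit :: "sandpile \<Rightarrow> point \<Rightarrow> ennreal" where
  "odometer_limit \<sigma> x = lim (\<lambda>n. of_nat (odometer n \<sigma> x))"

definition stabilizable :: "sandpile \<Rightarrow> bool" where
  "stabilizable \<sigma> \<longleftrightarrow> (\<forall>x\<in>SG. odometer_limit \<sigma> x < \<infinity>)"

end

theory Submission
  imports Defs
begin

text \<open>
The gasket is finitely ramified: level \<open>n\<close> of the graph is connected to the rest only through four outer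
corners. Let \<open>h\<^sub>n\<close> (\<open>green n\<close> below) be the function on level \<open>n\<close> that equals 1 at the origin \<open>o\<close>, equals 0 at the
outer corners, and is harmonic elsewhere. A toppling at \<open>x\<close> changes the weighted number of chips
\<open>\<Sum> h\<^sub>n(x) \<sigma>(x)\<close> by the Laplacian of \<open>h\<^sub>n\<close> at \<open>x\<close>. This is 0 at
harmonic vertices, nonnegative at the outer corners, and \<open>-4 (3/5)\<^sup>n\<close> at the origin. When toppling
ends, every vertex of level \<open>n\<close> holds at most 3 chips. Hence the odometer satisfies
\<open>u\<^sub>n(o) \<ge> (5/3)\<^sup>n \<Sum> h\<^sub>n(x) (\<sigma>(x) - 3)\<close>
(\<open>odometer_origin_ge\<close>). This bound is for the finite levels themselves, so the infinite graph enters only through the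
monotonicity of \<open>u\<^sub>n\<close> in \<open>n\<close>.

It remains to see that the sums on the right are almost surely unbounded above. As \<open>h\<^sub>n \<ge> 0\<close> and the mean is at
least 3, they dominate the same sums centred at the mean. These are weighted sums of centred
i.i.d. variables with finite positive variance and weights in \<open>[0, 1]\<close>; the weights are at least
2/5 on the previous level, so the sum of their squares diverges. A weighted central limit theorem shows
that such a sum exceeds its standard deviation with a probability bounded away from 0, and the Borel
zero-one law, applied to independent blocks of a sparse subsequence, makes this happen
infinitely often almost surely (\<open>weighted_sums_unbounded\<close>).

The harmonic function is constructed by recursion on the level. Its Laplacian, like the vertex degrees, is
computed in weak form: one evaluates a sum over all triangles against an arbitrary test function, by an
induction that uses only how the three copies of a level are joined (\<open>harmonic_green\<close>, \<open>sum_over_cells\<close>),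
and then inserts indicator functions. That the odometer is well defined needs the abelian property
(\<open>legal_topplings_mset_le\<close>) and the termination of toppling (\<open>ex_stabilizing_topplings\<close>).
\<close>

section \<open>The abelian property\<close>

definition neighbours :: "point \<Rightarrow> point set" where
  "neighbours x = {y. y \<noteq> x \<and> {x, y} \<in> SG_edges}"

lemma topple_eq:
  "topple x \<sigma> y = (if y = x then \<sigma> y - 4 else if y \<in> neighbours x then \<sigma> y + 1 else \<sigma> y)"
  by (simp add: topple_def neighbours_def)

text \<open>Written as an equation without subtraction. Legality makes the truncated subtraction in
\<^const>\<open>topple\<close> exact, so the final pile depends on the sequence only through how often
each vertex topples.\<close>

lemma fold_topple_eq:
  assumes "legal_topplings n \<sigma> xs"
  shows "fold topple xs \<sigma> y + 4 * count_list xs y = \<sigma> y + length (filter (\<lambda>x. y \<in> neighbours x) xs)"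
  using assms
proof (induction xs arbitrary: \<sigma>)
  case (Cons x xs)
  then have IH: "fold topple xs (topple x \<sigma>) y + 4 * count_list xs y
      = topple x \<sigma> y + length (filter (\<lambda>x. y \<in> neighbours x) xs)" by simp
  have "topple x \<sigma> y + (if x = y then 4 else 0) = \<sigma> y + (if y \<in> neighbours x then 1 else 0)"
    using Cons.prems by (auto simp: topple_eq neighbours_def unstable_def)
  then show ?case using IH by (auto split: if_splits)
qed simp

lemma legal_topplings_snoc:
  "legal_topplings n \<sigma> (xs @ [x]) \<longleftrightarrow>
     legal_topplings n \<sigma> xs \<and> x \<in> SG_level n \<and> unstable (fold topple xs \<sigma>) x"
  by (induction xs arbitrary: \<sigma>) auto

text \<open>The least action principle: a legal sequence on a smaller level topples no vertex more often than a
stabilizing sequence on a larger level. Suppose the next vertex of the legal sequence had already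
used up its share. Its pile would then have lost as much as under the stabilizing sequence and
gained at most as much, so it would be stable already. Taking equal levels this gives uniqueness
of the odometer, taking nested levels its monotonicity.\<close>

lemma legal_topplings_mset_le:
  assumes "SG_level n \<subseteq> SG_level m"
    and "legal_topplings n \<sigma> xs" and ys: "stabilizing_topplings m \<sigma> ys"
  shows "mset xs \<subseteq># mset ys"
  using assms(2)
proof (induction xs rule: rev_induct)
  case (snoc x xs)
  then have legal: "legal_topplings n \<sigma> xs" and x: "x \<in> SG_level m" and unstable: "fold topple xs \<sigma> x \<ge> 4"
    using assms(1) by (auto simp: legal_topplings_snoc unstable_def)
  have sub: "mset xs \<subseteq># mset ys" using snoc.IH legal .
  have ys_legal: "legal_topplings m \<sigma> ys" and stable: "fold topple ys \<sigma> x < 4"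
    using ys x by (auto simp: stabilizing_topplings_def unstable_def)
  have received: "length (filter (\<lambda>z. x \<in> neighbours z) xs) \<le> length (filter (\<lambda>z. x \<in> neighbours z) ys)"
    using size_mset_mono[OF multiset_filter_mono[OF sub, of "\<lambda>z. x \<in> neighbours z"]]
    by (simp flip: mset_filter)
  have "count_list xs x < count_list ys x"
    using received fold_topple_eq[OF legal, of x] fold_topple_eq[OF ys_legal, of x] unstable stable
    by linarith
  then show ?case
    using sub by (auto simp: subseteq_mset_def count_mset)
qed simp

lemma odometer_eq:
  assumes "stabilizing_topplings n \<sigma> xs"
  shows "odometer n \<sigma> x = 4 * count_list xs x"
proof -
  have "odometer n \<sigma> = (\<lambda>x. 4 * count_list xs x)"
    unfolding odometer_def
  proof (rule the_equality)
    fix u assume "\<exists>ys. stabilizing_topplings n \<sigma> ys \<and> u = (\<lambda>x. 4 * count_list ys x)"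
    then obtain ys where ys: "stabilizing_topplings n \<sigma> ys" and u: "u = (\<lambda>x. 4 * count_list ys x)"
      by blast
    have "mset xs = mset ys"
      using assms ys by (intro subset_mset.antisym legal_topplings_mset_le)
        (auto simp: stabilizing_topplings_def)
    then show "u = (\<lambda>x. 4 * count_list xs x)"
      unfolding u by (metis count_mset)
  qed (use assms in blast)
  then show ?thesis by simp
qed

lemma odometer_mono:
  assumes "SG_level n \<subseteq> SG_level m"
    and "stabilizing_topplings n \<sigma> xs" "stabilizing_topplings m \<sigma> ys"
  shows "odometer n \<sigma> x \<le> odometer m \<sigma> x"
proof -
  have "mset xs \<subseteq># mset ys"
    using assms by (intro legal_topplings_mset_le) (auto simp: stabilizing_topplings_def)
  then have "count_list xs x \<le> count_list ys x"
    unfolding count_mset[symmetric] by (rule mset_subset_eq_count)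
  then show ?thesis
    using assms by (simp add: odometer_eq)
qed

text \<open>A nonnegative potential that drops by at least 1 with every toppling bounds the length of legal
sequences, and a legal sequence of maximal length is stabilizing.\<close>

lemma ex_stabilizing_if_potential:
  fixes \<Phi> :: "sandpile \<Rightarrow> real"
  assumes nonneg: "\<And>\<sigma>. \<Phi> \<sigma> \<ge> 0"
    and decr: "\<And>\<sigma> x. x \<in> SG_level n \<Longrightarrow> unstable \<sigma> x \<Longrightarrow> \<Phi> (topple x \<sigma>) \<le> \<Phi> \<sigma> - 1"
  shows "\<exists>xs. stabilizing_topplings n \<sigma> xs"
proof -
  have "length xs \<le> \<Phi> \<sigma>" if "legal_topplings n \<sigma> xs" for xs
    using that
  proof (induction xs arbitrary: \<sigma>)
    case (Cons x xs)
    then have "length xs \<le> \<Phi> (topple x \<sigma>)" and "\<Phi> (topple x \<sigma>) \<le> \<Phi> \<sigma> - 1"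
      by (auto intro!: decr)
    then show ?case by simp
  qed (simp add: nonneg)
  then have bounded: "\<forall>xs. legal_topplings n \<sigma> xs \<longrightarrow> length xs < Suc (nat \<lfloor>\<Phi> \<sigma>\<rfloor>)"
    by (auto simp: le_nat_floor less_Suc_eq_le)
  obtain xs where xs: "legal_topplings n \<sigma> xs"
    and longest: "\<forall>ys. legal_topplings n \<sigma> ys \<longrightarrow> length ys \<le> length xs"
    using ex_has_greatest_nat[of "legal_topplings n \<sigma>" "[]" length, OF _ bounded] by auto
  have "\<not> unstable (fold topple xs \<sigma>) x" if "x \<in> SG_level n" for x
  proof
    assume "unstable (fold topple xs \<sigma>) x"
    then have "legal_topplings n \<sigma> (xs @ [x])"
      using xs that by (simp add: legal_topplings_snoc)
    then show False using longest by fastforce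
  qed
  then show ?thesis
    using xs by (auto simp: stabilizing_topplings_def)
qed

section \<open>The right half of the gasket and its cells\<close>

definition right_corner :: "nat \<Rightarrow> point" where "right_corner n = (2 ^ n, 0)"
definition top_corner :: "nat \<Rightarrow> point" where "top_corner n = (2 ^ n / 2, 2 ^ n / 2 * sqrt 3)"

text \<open>Coordinates with respect to the lattice basis \<open>(1, 0)\<close>, \<open>(1/2, sqrt 3 / 2)\<close>. In these
coordinates \<^term>\<open>V n\<close> lies in the triangle with corners \<open>(0, 0)\<close>,
\<open>(2^n, 0)\<close>, \<open>(0, 2^n)\<close>, and all incidences between translated copies reduce to linear
inequalities.\<close>

definition coord1 :: "point \<Rightarrow> real" where "coord1 p = fst p - snd p / sqrt 3"
definition coord2 :: "point \<Rightarrow> real" where "coord2 p = 2 * snd p / sqrt 3"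

lemma coord_simps [simp]:
  "coord1 0 = 0" "coord2 0 = 0"
  "coord1 (p + q) = coord1 p + coord1 q" "coord2 (p + q) = coord2 p + coord2 q"
  "coord1 (p - q) = coord1 p - coord1 q" "coord2 (p - q) = coord2 p - coord2 q"
  "coord1 (right_corner n) = 2 ^ n" "coord2 (right_corner n) = 0"
  "coord1 (top_corner n) = 0" "coord2 (top_corner n) = 2 ^ n"
  by (auto simp: coord1_def coord2_def right_corner_def top_corner_def field_simps)

lemma point_eq_iff: "p = q \<longleftrightarrow> coord1 p = coord1 q \<and> coord2 p = coord2 q"
  by (auto simp: coord1_def coord2_def prod_eq_iff)

lemma corner_Suc:
  "right_corner (Suc n) = right_corner n + right_corner n"
  "top_corner (Suc n) = top_corner n + top_corner n"
  by (simp_all add: point_eq_iff)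

lemma corner_neq [simp]:
  "right_corner n \<noteq> 0" "top_corner n \<noteq> 0" "right_corner n \<noteq> top_corner n" "top_corner n \<noteq> right_corner n"
  "right_corner n \<noteq> top_corner n + right_corner n"
  "0 \<noteq> right_corner n" "0 \<noteq> top_corner n"
  by (simp_all add: point_eq_iff)

lemma V_0: "V 0 = {0, right_corner 0, top_corner 0}"
  by (simp add: right_corner_def top_corner_def zero_prod_def)

lemma V_Suc: "V (Suc n) = V n \<union> (+) (right_corner n) ` V n \<union> (+) (top_corner n) ` V n"
  by (simp add: right_corner_def top_corner_def)

declare V.simps [simp del]

lemma V_bounds:
  assumes "p \<in> V n"
  shows "0 \<le> coord1 p" "0 \<le> coord2 p" "coord1 p + coord2 p \<le> 2 ^ n"
proof -
  have "0 \<le> coord1 p \<and> 0 \<le> coord2 p \<and> coord1 p + coord2 p \<le> 2 ^ n"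
    using assms by (induction n arbitrary: p) (fastforce simp: V_0 V_Suc)+
  then show "0 \<le> coord1 p" "0 \<le> coord2 p" "coord1 p + coord2 p \<le> 2 ^ n" by auto
qed

lemma translate_mem_iff: "p \<in> (+) q ` A \<longleftrightarrow> p - q \<in> A" for p q :: point
  by (force simp: image_iff algebra_simps)

lemma finite_V [simp]: "finite (V n)"
  by (induction n) (simp_all add: V_0 V_Suc)

lemma corners_in_V [simp]: "0 \<in> V n" "right_corner n \<in> V n" "top_corner n \<in> V n"
  by (induction n) (auto simp: V_0 V_Suc corner_Suc)

text \<open>Finite ramification: the three copies that form the next level touch only in single vertices. This is
what makes sums over the gasket, and the harmonic functions below, computable by recursion.\<close>

lemma V_pieces_meet:
  "V n \<inter> (+) (right_corner n) ` V n = {right_corner n}"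
  "V n \<inter> (+) (top_corner n) ` V n = {top_corner n}"
  "(+) (right_corner n) ` V n \<inter> (+) (top_corner n) ` V n = {right_corner n + top_corner n}"
proof -
  have "right_corner n \<in> (+) (right_corner n) ` V n" "top_corner n \<in> (+) (top_corner n) ` V n"
     "right_corner n + top_corner n \<in> (+) (right_corner n) ` V n"
     "right_corner n + top_corner n \<in> (+) (top_corner n) ` V n"
    by (simp_all add: translate_mem_iff)
  moreover have "p = right_corner n" if "p \<in> V n" "p \<in> (+) (right_corner n) ` V n" for p
    using V_bounds[of p n] V_bounds[of "p - right_corner n" n] that
    by (simp add: point_eq_iff translate_mem_iff)
  moreover have "p = top_corner n" if "p \<in> V n" "p \<in> (+) (top_corner n) ` V n" for p
    using V_bounds[of p n] V_bounds[of "p - top_corner n" n] that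
    by (simp add: point_eq_iff translate_mem_iff)
  moreover have "p = right_corner n + top_corner n"
    if "p \<in> (+) (right_corner n) ` V n" "p \<in> (+) (top_corner n) ` V n" for p
    using V_bounds[of "p - right_corner n" n] V_bounds[of "p - top_corner n" n] that
    by (simp add: point_eq_iff translate_mem_iff)
  ultimately show
    "V n \<inter> (+) (right_corner n) ` V n = {right_corner n}"
    "V n \<inter> (+) (top_corner n) ` V n = {top_corner n}"
    "(+) (right_corner n) ` V n \<inter> (+) (top_corner n) ` V n = {right_corner n + top_corner n}"
    using corners_in_V by blast+
qed

lemma sum_V_Suc:
  fixes u :: "point \<Rightarrow> real"
  shows "sum u (V (Suc n)) = sum u (V n) + (\<Sum>x\<in>V n. u (right_corner n + x)) + (\<Sum>x\<in>V n. u (top_corner n + x))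
    - u (right_corner n) - u (top_corner n) - u (right_corner n + top_corner n)"
proof -
  let ?R = "(+) (right_corner n) ` V n" and ?T = "(+) (top_corner n) ` V n"
  have "sum u (V n \<union> ?R) = sum u (V n) + sum u ?R - u (right_corner n)"
    by (subst sum_Un) (simp_all add: V_pieces_meet)
  moreover have "sum u (V n \<union> ?R \<union> ?T) = sum u (V n \<union> ?R) + sum u ?T
      - u (top_corner n) - u (right_corner n + top_corner n)"
  proof -
    have "(V n \<union> ?R) \<inter> ?T = {top_corner n, right_corner n + top_corner n}"
      using V_pieces_meet by blast
    then show ?thesis by (subst sum_Un) (simp_all)
  qed
  moreover have "sum u ?R = (\<Sum>x\<in>V n. u (right_corner n + x))" "sum u ?T = (\<Sum>x\<in>V n. u (top_corner n + x))"
    by (simp_all add: sum.reindex)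
  ultimately show ?thesis by (simp add: V_Suc)
qed

text \<open>The unit triangles of the gasket, as sets of vertices. The edges are exactly the pairs of vertices
within one cell, and cells are easier to count and to sum over than edges.\<close>

fun cells :: "nat \<Rightarrow> point set set" where
  "cells 0 = {V 0}"
| "cells (Suc n) = cells n \<union> (`) ((+) (right_corner n)) ` cells n \<union> (`) ((+) (top_corner n)) ` cells n"

definition up_triangle :: "point \<Rightarrow> point set" where
  "up_triangle p = {p, p + right_corner 0, p + top_corner 0}"

lemma cells_up_triangle: "c \<in> cells n \<Longrightarrow> \<exists>p. c = up_triangle p"
proof (induction n arbitrary: c)
  case 0
  then show ?case by (intro exI[of _ 0]) (simp add: V_0 up_triangle_def)
next
  case (Suc n)
  have "(+) q ` up_triangle p = up_triangle (q + p)" for p q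
    by (auto simp: up_triangle_def add.assoc)
  then have "\<exists>p. (+) q ` c' = up_triangle p" if "c' \<in> cells n" for q c'
    using Suc.IH[OF that] by metis
  then show ?case using Suc.prems Suc.IH unfolding cells.simps by blast
qed

lemma card_up_triangle [simp]: "card (up_triangle p) = 3"
  by (simp add: up_triangle_def)

lemma finite_up_triangle [simp]: "finite (up_triangle p)"
  by (simp add: up_triangle_def)

lemma up_triangle_corner_min:
  assumes "x \<in> up_triangle p" "y \<in> up_triangle p" "x \<noteq> y"
  shows "coord1 p = min (coord1 x) (coord1 y)" "coord2 p = min (coord2 x) (coord2 y)"
  using assms by (auto simp: up_triangle_def)

text \<open>Two vertices of an upward triangle determine its lower left corner: each lattice coordinate of the
corner is the smaller of the coordinates of the two vertices.\<close>

lemma up_triangles_share_at_most_one_vertex: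
  assumes "x \<in> up_triangle p" "y \<in> up_triangle p" "x \<in> up_triangle q" "y \<in> up_triangle q" "x \<noteq> y"
  shows "p = q"
  using up_triangle_corner_min[OF assms(1,2,5)] up_triangle_corner_min[OF assms(3,4,5)]
  by (simp add: point_eq_iff)

lemma finite_cells [simp]: "finite (cells n)"
  by (induction n) auto

lemma Union_cells: "\<Union> (cells n) = V n"
  by (induction n) (simp_all add: V_Suc flip: image_Union)

lemma cell_card: "c \<in> cells n \<Longrightarrow> card c = 3"
  using cells_up_triangle by fastforce

lemma cell_not_subset_singleton: "c \<in> cells n \<Longrightarrow> \<not> c \<subseteq> {z}"
  using cell_card[of c n] card_mono[of "{z}" c] by auto

lemma sum_cells_Suc:
  fixes F :: "point set \<Rightarrow> real"
  shows "sum F (cells (Suc n)) = sum F (cells n) + (\<Sum>c\<in>cells n. F ((+) (right_corner n) ` c))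
    + (\<Sum>c\<in>cells n. F ((+) (top_corner n) ` c))"
proof -
  let ?R = "(`) ((+) (right_corner n)) ` cells n" and ?T = "(`) ((+) (top_corner n)) ` cells n"
  have sub: "c \<in> cells n \<Longrightarrow> c \<subseteq> V n" "c \<in> ?R \<Longrightarrow> c \<subseteq> (+) (right_corner n) ` V n"
     "c \<in> ?T \<Longrightarrow> c \<subseteq> (+) (top_corner n) ` V n" for c
    using Union_cells[of n] by blast+
  have sing: "\<not> c \<subseteq> {z}" if "c \<in> cells n \<union> ?R \<union> ?T" for c z
    using that cell_not_subset_singleton[of c "Suc n" z] by simp
  have "c \<notin> ?R" if "c \<in> cells n" for c
    using sub(1,2)[of c] sing[of c "right_corner n"] that unfolding V_pieces_meet(1)[symmetric] by blast
  moreover have "c \<notin> ?T" if "c \<in> cells n" for c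
    using sub(1,3)[of c] sing[of c "top_corner n"] that unfolding V_pieces_meet(2)[symmetric] by blast
  moreover have "c \<notin> ?T" if "c \<in> ?R" for c
    using sub(2,3)[of c] sing[of c "right_corner n + top_corner n"] that
    unfolding V_pieces_meet(3)[symmetric] by blast
  ultimately have "cells n \<inter> ?R = {}" "(cells n \<union> ?R) \<inter> ?T = {}"
    by blast+
  then have "sum F (cells (Suc n)) = sum F (cells n) + sum F ?R + sum F ?T"
    by (simp add: sum.union_disjoint)
  moreover have "inj_on ((`) ((+) p)) A" for p :: point and A
    by (intro inj_onI) (simp add: inj_image_eq_iff)
  ultimately show ?thesis by (simp add: sum.reindex)
qed

text \<open>A weak form of the statement that the three extreme corners lie in one cell and all other vertices in two.
Phrased with a test function \<open>u\<close> it follows by induction from the recursive structure alone, with no case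
distinction on the position of a vertex; indicator functions recover the pointwise statement. The
harmonic functions below are treated in the same way.\<close>

lemma sum_over_cells:
  fixes u :: "point \<Rightarrow> real"
  shows "(\<Sum>c\<in>cells n. \<Sum>x\<in>c. u x)
    = 2 * (\<Sum>x\<in>V n. u x) - (u 0 + u (right_corner n) + u (top_corner n))"
proof (induction n arbitrary: u)
  case 0
  show ?case by (simp add: V_0)
next
  case (Suc n)
  show ?case
    unfolding sum_cells_Suc sum_V_Suc
    by (simp add: sum.reindex Suc.IH corner_Suc add.commute[of "top_corner n" "right_corner n"])
qed

section \<open>Harmonic functions\<close>

text \<open>The harmonic function on \<^term>\<open>V n\<close> with prescribed values \<open>a\<close>, \<open>b\<close>, \<open>c\<close> at the lower
left, right and top corner. The values at the three junctions are given by the ``1/5-2/5 rule'': the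
junction between two corners weighs these by 2/5 each and the opposite corner by 1/5.\<close>

primrec harmonic :: "nat \<Rightarrow> real \<Rightarrow> real \<Rightarrow> real \<Rightarrow> point \<Rightarrow> real" where
  "harmonic 0 a b c p = (if p = 0 then a else if p = right_corner 0 then b else c)"
| "harmonic (Suc n) a b c p =
    (if p \<in> V n then harmonic n a ((2 * a + 2 * b + c) / 5) ((2 * a + b + 2 * c) / 5) p
     else if p - right_corner n \<in> V n
       then harmonic n ((2 * a + 2 * b + c) / 5) b ((a + 2 * b + 2 * c) / 5) (p - right_corner n)
     else harmonic n ((2 * a + b + 2 * c) / 5) ((a + 2 * b + 2 * c) / 5) c (p - top_corner n))"

lemma harmonic_corners [simp]:
  "harmonic n a b c 0 = a" "harmonic n a b c (right_corner n) = b" "harmonic n a b c (top_corner n) = c"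
proof -
  have "harmonic n a b c 0 = a \<and> harmonic n a b c (right_corner n) = b \<and> harmonic n a b c (top_corner n) = c"
  proof (induction n arbitrary: a b c)
  case (Suc n)
  have "right_corner n + right_corner n \<notin> V n"
    using V_bounds(1,3)[of "right_corner n + right_corner n" n] by auto
  moreover have "top_corner n + top_corner n \<notin> V n"
    using V_bounds(2,3)[of "top_corner n + top_corner n" n] by auto
  moreover have "top_corner n + top_corner n - right_corner n \<notin> V n"
    using V_bounds(1)[of "top_corner n + top_corner n - right_corner n" n]
    by (auto simp: power_le_zero_eq)
  ultimately show ?case
    using Suc by (simp_all add: corner_Suc)
  qed auto
  then show "harmonic n a b c 0 = a" "harmonic n a b c (right_corner n) = b" "harmonic n a b c (top_corner n) = c"
    by auto
qed

text \<open>At a junction two branches of the recursion apply, and they agree because both prescribe the same corner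
value there.\<close>

lemma harmonic_pieces:
  assumes "q \<in> V n"
  shows "harmonic (Suc n) a b c q = harmonic n a ((2 * a + 2 * b + c) / 5) ((2 * a + b + 2 * c) / 5) q"
    and "harmonic (Suc n) a b c (right_corner n + q)
      = harmonic n ((2 * a + 2 * b + c) / 5) b ((a + 2 * b + 2 * c) / 5) q"
    and "harmonic (Suc n) a b c (top_corner n + q)
      = harmonic n ((2 * a + b + 2 * c) / 5) ((a + 2 * b + 2 * c) / 5) c q"
proof -
  show "harmonic (Suc n) a b c q = harmonic n a ((2 * a + 2 * b + c) / 5) ((2 * a + b + 2 * c) / 5) q"
    using assms by simp
  have "q = 0" if "right_corner n + q \<in> V n"
    using V_pieces_meet(1)[of n] that assms by (metis IntI add_cancel_left_right imageI singletonD)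
  then show "harmonic (Suc n) a b c (right_corner n + q)
      = harmonic n ((2 * a + 2 * b + c) / 5) b ((a + 2 * b + 2 * c) / 5) q"
    using assms by auto
  have "q = 0" if "top_corner n + q \<in> V n"
    using V_pieces_meet(2)[of n] that assms by (metis IntI add_cancel_left_right imageI singletonD)
  moreover have "q = right_corner n" if "top_corner n + q - right_corner n \<in> V n"
  proof -
    have "top_corner n + q \<in> (+) (right_corner n) ` V n \<inter> (+) (top_corner n) ` V n"
      using that assms by (simp add: translate_mem_iff)
    then have "top_corner n + q = top_corner n + right_corner n"
      unfolding V_pieces_meet by (simp add: add.commute)
    then show ?thesis by simp
  qed
  ultimately show "harmonic (Suc n) a b c (top_corner n + q)
      = harmonic n ((2 * a + b + 2 * c) / 5) ((a + 2 * b + 2 * c) / 5) c q"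
    using assms by (auto)
qed

text \<open>The maximum principle. It holds at every point of the plane, as all values arise from the corner
values by repeated convex combination.\<close>

lemma harmonic_bounds:
  assumes "l \<le> a" "l \<le> b" "l \<le> c" "a \<le> h" "b \<le> h" "c \<le> h"
  shows "l \<le> harmonic n a b c p" "harmonic n a b c p \<le> h"
proof -
  have "l \<le> harmonic n a b c p \<and> harmonic n a b c p \<le> h"
    using assms
  proof (induction n arbitrary: a b c p)
    case (Suc n)
    have "l \<le> (2 * a + 2 * b + c) / 5" "l \<le> (2 * a + b + 2 * c) / 5" "l \<le> (a + 2 * b + 2 * c) / 5"
      "(2 * a + 2 * b + c) / 5 \<le> h" "(2 * a + b + 2 * c) / 5 \<le> h" "(a + 2 * b + 2 * c) / 5 \<le> h"
      using Suc.prems by auto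
    then show ?case using Suc by auto
  qed auto
  then show "l \<le> harmonic n a b c p" "harmonic n a b c p \<le> h" by auto
qed

text \<open>Green's formula for harmonic functions: only the corners contribute, so
the graph Laplacian vanishes elsewhere. The factor \<open>3/5\<close> per level is the renormalization factor of
the gasket; at each junction the contributions of the two adjacent copies cancel, which is
precisely the 1/5-2/5 rule.\<close>

lemma harmonic_green:
  fixes u :: "point \<Rightarrow> real"
  shows "(\<Sum>t\<in>cells n. \<Sum>x\<in>t. \<Sum>y\<in>t. u x * (harmonic n a b c x - harmonic n a b c y))
    = (3 / 5) ^ n * (u 0 * (2 * a - b - c) + u (right_corner n) * (2 * b - a - c)
        + u (top_corner n) * (2 * c - a - b))"
proof (induction n arbitrary: u a b c)
  case 0
  show ?case by (simp add: V_0 algebra_simps)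
next
  case (Suc n)
  define ab where "ab = (2 * a + 2 * b + c) / 5"
  define ac where "ac = (2 * a + b + 2 * c) / 5"
  define bc where "bc = (a + 2 * b + 2 * c) / 5"
  have inV: "x \<in> V n" if "t \<in> cells n" "x \<in> t" for t x
    using that Union_cells by blast
  have "(\<Sum>t\<in>cells (Suc n). \<Sum>x\<in>t. \<Sum>y\<in>t. u x * (harmonic (Suc n) a b c x - harmonic (Suc n) a b c y))
    = (\<Sum>t\<in>cells n. \<Sum>x\<in>t. \<Sum>y\<in>t. u x * (harmonic n a ab ac x - harmonic n a ab ac y))
    + (\<Sum>t\<in>cells n. \<Sum>x\<in>t. \<Sum>y\<in>t. u (right_corner n + x) * (harmonic n ab b bc x - harmonic n ab b bc y))
    + (\<Sum>t\<in>cells n. \<Sum>x\<in>t. \<Sum>y\<in>t. u (top_corner n + x) * (harmonic n ac bc c x - harmonic n ac bc c y))"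
    unfolding sum_cells_Suc ab_def ac_def bc_def
    by (rule arg_cong2[where f="(+)"], rule arg_cong2[where f="(+)"]; rule sum.cong[OF refl])
       (simp_all add: sum.reindex harmonic_pieces inV del: harmonic.simps cong: sum.cong)
  also have "\<dots> = (3 / 5) ^ Suc n * (u 0 * (2 * a - b - c) + u (right_corner (Suc n)) * (2 * b - a - c)
        + u (top_corner (Suc n)) * (2 * c - a - b))"
    unfolding Suc.IH
    by (simp add: corner_Suc add.commute[of "top_corner n" "right_corner n"] ab_def ac_def bc_def field_simps)
  finally show ?case .
qed

section \<open>The doubly-infinite gasket and its neighbourhoods\<close>

(* Quantified points stay whole from here on, so that facts about lattice coordinates still match. *)
declare split_paired_All [simp del] split_paired_Ex [simp del]

lemma reflect_simps [simp]:
  "reflect 0 = 0" "reflect (reflect p) = p" "reflect p = reflect q \<longleftrightarrow> p = q"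
  "reflect (p + q) = reflect p + reflect q"
  by (auto simp: reflect_def prod_eq_iff)

lemma inj_reflect [simp]: "inj_on reflect A"
  by (simp add: inj_on_def)

lemma reflect_mem_iff: "p \<in> reflect ` A \<longleftrightarrow> reflect p \<in> A"
  by (metis image_iff reflect_simps(2))

lemma coord_reflect [simp]: "coord1 (reflect p) = - coord1 p - coord2 p" "coord2 (reflect p) = coord2 p"
  by (simp_all add: coord1_def coord2_def reflect_def field_simps)

text \<open>A vertex in both halves and its mirror image both have nonnegative lattice coordinates. The first
coordinates of the two add up to minus the second coordinate, so all of them vanish.\<close>

lemma V_halves_meet: "V n \<inter> reflect ` V n = {0}"
proof -
  have "p = 0" if "p \<in> V n" "reflect p \<in> V n" for p
    using V_bounds[OF that(1)] V_bounds[OF that(2)] by (simp add: point_eq_iff)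
  moreover have "0 \<in> V n" "reflect 0 \<in> V n" by simp_all
  ultimately show ?thesis
    by (intro subset_antisym subsetI) (simp_all add: reflect_mem_iff)
qed

lemma finite_SG_level [simp]: "finite (SG_level n)"
  by (simp add: SG_level_def)

lemma sum_SG_level:
  fixes u :: "point \<Rightarrow> real"
  shows "sum u (SG_level n) = sum u (V n) + (\<Sum>x\<in>V n. u (reflect x)) - u 0"
  unfolding SG_level_def by (subst sum_Un) (simp_all add: V_halves_meet sum.reindex)

definition level_cells :: "nat \<Rightarrow> point set set" where
  "level_cells n = cells n \<union> (`) reflect ` cells n"

text \<open>The four vertices of \<^term>\<open>SG_level n\<close> that have neighbours outside. The origin is interior,
since both halves meet there.\<close>

definition outer_corners :: "nat \<Rightarrow> point set" where
  "outer_corners n = {right_corner n, top_corner n, reflect (right_corner n), reflect (top_corner n)}"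

lemma finite_level_cells [simp]: "finite (level_cells n)"
  by (simp add: level_cells_def)

lemma Union_level_cells: "\<Union> (level_cells n) = SG_level n"
  by (simp add: level_cells_def SG_level_def Union_cells flip: image_Union)

lemma level_cells_up_triangle: "c \<in> level_cells n \<Longrightarrow> \<exists>p. c = up_triangle p"
proof -
  have "reflect ` up_triangle p = up_triangle (reflect p - right_corner 0)" for p
    by (auto simp: up_triangle_def point_eq_iff)
  then have "\<exists>q. reflect ` c' = up_triangle q" if "c' \<in> cells n" for c'
    using cells_up_triangle[OF that] by metis
  then show "\<exists>p. c = up_triangle p" if "c \<in> level_cells n"
    using that cells_up_triangle unfolding level_cells_def by blast
qed

lemma finite_level_cell: "c \<in> level_cells n \<Longrightarrow> finite c"
  using level_cells_up_triangle by (metis finite_up_triangle)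

lemma sum_level_cells:
  fixes F :: "point set \<Rightarrow> real"
  shows "sum F (level_cells n) = sum F (cells n) + (\<Sum>c\<in>cells n. F (reflect ` c))"
proof -
  have "c \<notin> (`) reflect ` cells n" if "c \<in> cells n" for c
  proof
    assume "c \<in> (`) reflect ` cells n"
    then have "c \<subseteq> V n \<inter> reflect ` V n"
      using that Union_cells[of n] by blast
    then show False
      using cell_not_subset_singleton[OF that] by (simp add: V_halves_meet)
  qed
  then have "cells n \<inter> (`) reflect ` cells n = {}" by blast
  moreover have "inj_on ((`) reflect) (cells n)"
    by (intro inj_onI) (simp add: inj_image_eq_iff)
  ultimately show ?thesis
    by (simp add: level_cells_def sum.union_disjoint sum.reindex)
qed

lemma sum_over_level_cells:
  fixes u :: "point \<Rightarrow> real"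
  shows "(\<Sum>c\<in>level_cells n. \<Sum>x\<in>c. u x) = 2 * (\<Sum>x\<in>SG_level n. u x)
    - (u (right_corner n) + u (top_corner n) + u (reflect (right_corner n)) + u (reflect (top_corner n)))"
  unfolding sum_level_cells sum_SG_level by (simp add: sum.reindex sum_over_cells)

text \<open>Turns a weak formula into a pointwise one by testing it with the indicator of a vertex.\<close>

lemma sum_cells_indicator:
  fixes f :: "point \<Rightarrow> point set \<Rightarrow> real"
  shows "(\<Sum>c\<in>level_cells n. \<Sum>x\<in>c. indicator {z} x * f x c) = (\<Sum>c\<in>{c\<in>level_cells n. z \<in> c}. f z c)"
proof -
  have "(\<Sum>x\<in>c. indicator {z} x * f x c) = (if z \<in> c then f z c else 0)" if "c \<in> level_cells n" for c
  proof -
    have "finite c" using finite_level_cell[OF that] .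
    then show ?thesis by (simp add: indicator_def sum.delta' if_distrib[of "\<lambda>t. t * _"] cong: if_cong)
  qed
  then show ?thesis by (simp add: sum.inter_filter)
qed

lemma card_cells_at_vertex:
  assumes "x \<in> SG_level n" "x \<notin> outer_corners n"
  shows "card {c \<in> level_cells n. x \<in> c} = 2"
proof -
  have "real (card {c \<in> level_cells n. x \<in> c}) = (\<Sum>c\<in>level_cells n. \<Sum>y\<in>c. indicator {x} y)"
    using sum_cells_indicator[of x "\<lambda>_ _. 1" n] by simp
  also have "\<dots> = 2"
    using assms by (simp add: sum_over_level_cells outer_corners_def indicator_def eq_commute[of _ x])
  finally show ?thesis by simp
qed

lemma V_mono: "n \<le> m \<Longrightarrow> V n \<subseteq> V m"
  by (rule lift_Suc_mono_le[of V]) (auto simp: V_Suc)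

lemma SG_level_mono: "n \<le> m \<Longrightarrow> SG_level n \<subseteq> SG_level m"
  unfolding SG_level_def by (intro Un_mono image_mono V_mono)

lemma level_cells_mono: "n \<le> m \<Longrightarrow> level_cells n \<subseteq> level_cells m"
  unfolding level_cells_def
  by (intro Un_mono image_mono) (rule lift_Suc_mono_le[of cells]; auto)+

text \<open>Every vertex is interior to all later levels, so its degree in the infinite graph
can be read off from the next level.\<close>

lemma outer_corners_escape:
  assumes "x \<in> SG_level n" "n < m"
  shows "x \<notin> outer_corners m"
proof -
  have pow: "(2::real) ^ n < 2 ^ m" using assms(2) by simp
  have *: "x \<notin> outer_corners m" if "x \<in> V n" for x
  proof -
    have "x \<in> V m" using that V_mono[of n m] assms(2) by (simp add: subset_iff)
    have "0 < (2::real) ^ m" by simp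
    then have "x \<noteq> right_corner m" "x \<noteq> top_corner m"
      "x \<noteq> reflect (right_corner m)" "x \<noteq> reflect (top_corner m)"
      using V_bounds[OF that] V_bounds[OF \<open>x \<in> V m\<close>] pow
      by (simp_all only: point_eq_iff coord_simps coord_reflect) linarith+
    then show ?thesis by (simp add: outer_corners_def)
  qed
  have reflect_eq: "reflect y = q \<longleftrightarrow> y = reflect q" for y q
    by (metis reflect_simps(2))
  have "reflect y \<in> outer_corners m \<longleftrightarrow> y \<in> outer_corners m" for y
    unfolding outer_corners_def insert_iff empty_iff reflect_eq reflect_simps(2) by blast
  then have "x \<notin> outer_corners m" if "reflect x \<in> V n"
    using *[OF that] by simp
  moreover have "x \<in> V n \<or> reflect x \<in> V n"
    using assms(1) by (simp add: SG_level_def reflect_mem_iff)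
  ultimately show ?thesis using *[of x] by blast
qed

definition cell_edges :: "point set set \<Rightarrow> point set set" where
  "cell_edges C = {{x, y} | x y. x \<noteq> y \<and> (\<exists>c\<in>C. x \<in> c \<and> y \<in> c)}"

lemma cell_edges_Un: "cell_edges (C \<union> D) = cell_edges C \<union> cell_edges D"
  unfolding cell_edges_def by blast

lemma cell_edges_image:
  assumes "inj f"
  shows "cell_edges ((`) f ` C) = (`) f ` cell_edges C"
proof (intro subset_antisym subsetI)
  fix e assume "e \<in> cell_edges ((`) f ` C)"
  then obtain x y c where "c \<in> C" "x \<in> c" "y \<in> c" "f x \<noteq> f y" "e = {f x, f y}"
    unfolding cell_edges_def by blast
  then have "x \<noteq> y" by blast
  then have "{x, y} \<in> cell_edges C" "e = f ` {x, y}"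
    using \<open>c \<in> C\<close> \<open>x \<in> c\<close> \<open>y \<in> c\<close> \<open>e = {f x, f y}\<close>
    unfolding cell_edges_def by (blast, simp)
  then show "e \<in> (`) f ` cell_edges C" by blast
next
  fix e assume "e \<in> (`) f ` cell_edges C"
  then obtain x y c where "c \<in> C" "x \<in> c" "y \<in> c" "x \<noteq> y" "e = f ` {x, y}"
    unfolding cell_edges_def by blast
  then have "f x \<noteq> f y" "f x \<in> f ` c" "f y \<in> f ` c" "f ` c \<in> (`) f ` C" "e = {f x, f y}"
    using assms by (auto simp: inj_eq)
  then show "e \<in> cell_edges ((`) f ` C)"
    unfolding cell_edges_def by blast
qed

lemma E_eq_cell_edges: "E n = cell_edges (cells n)"
proof (induction n)
  case 0
  show ?case by (auto simp: cell_edges_def)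
next
  case (Suc n)
  then show ?case
    by (simp add: cell_edges_Un cell_edges_image right_corner_def top_corner_def)
qed

lemma SG_level_edges_eq: "SG_level_edges n = cell_edges (level_cells n)"
  by (simp add: SG_level_edges_def level_cells_def cell_edges_Un cell_edges_image E_eq_cell_edges)

lemma mem_cell_edges_iff:
  assumes "x \<noteq> y"
  shows "{x, y} \<in> cell_edges C \<longleftrightarrow> (\<exists>c\<in>C. x \<in> c \<and> y \<in> c)"
  using assms unfolding cell_edges_def mem_Collect_eq doubleton_eq_iff by blast

text \<open>The cells at a vertex only accumulate with the level, and from the next level on there are always two of them.\<close>

lemma cells_at_vertex_stabilize:
  assumes "x \<in> SG_level n" "n < m"
  shows "{c \<in> level_cells m. x \<in> c} = {c \<in> level_cells (Suc n). x \<in> c}"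
proof (rule card_subset_eq[symmetric])
  show "{c \<in> level_cells (Suc n). x \<in> c} \<subseteq> {c \<in> level_cells m. x \<in> c}"
    using level_cells_mono[of "Suc n" m] assms(2) by auto
  have "card {c \<in> level_cells k. x \<in> c} = 2" if "n < k" for k
    using that assms(1) SG_level_mono[of n k] outer_corners_escape
    by (intro card_cells_at_vertex) auto
  then show "card {c \<in> level_cells (Suc n). x \<in> c} = card {c \<in> level_cells m. x \<in> c}"
    using assms(2) by simp
qed simp

lemma neighbours_eq:
  assumes "x \<in> SG_level n"
  shows "neighbours x = (\<Union>c\<in>{c \<in> level_cells (Suc n). x \<in> c}. c - {x})"
proof -
  have "(\<exists>m. \<exists>c\<in>level_cells m. x \<in> c \<and> y \<in> c) \<longleftrightarrow> (\<exists>c\<in>level_cells (Suc n). x \<in> c \<and> y \<in> c)" for y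
  proof
    assume "\<exists>m. \<exists>c\<in>level_cells m. x \<in> c \<and> y \<in> c"
    then obtain m c where c: "c \<in> level_cells m" "x \<in> c" "y \<in> c" by blast
    then have "c \<in> level_cells (max m (Suc n))"
      using level_cells_mono[of m "max m (Suc n)"] by auto
    then have "c \<in> {c \<in> level_cells (max m (Suc n)). x \<in> c}" using c by simp
    then have "c \<in> {c \<in> level_cells (Suc n). x \<in> c}"
      by (subst (asm) cells_at_vertex_stabilize[OF assms]) simp_all
    then show "\<exists>c\<in>level_cells (Suc n). x \<in> c \<and> y \<in> c" using c by blast
  qed blast
  then have "y \<in> neighbours x \<longleftrightarrow> y \<noteq> x \<and> (\<exists>c\<in>level_cells (Suc n). x \<in> c \<and> y \<in> c)" for y
    by (cases "y = x") (simp_all add: neighbours_def SG_edges_def SG_level_edges_eq mem_cell_edges_iff)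
  then show ?thesis by blast
qed

lemma sum_neighbours:
  fixes f :: "point \<Rightarrow> real"
  assumes "x \<in> SG_level n"
  shows "sum f (neighbours x) = (\<Sum>c\<in>{c \<in> level_cells (Suc n). x \<in> c}. \<Sum>y\<in>c - {x}. f y)"
  unfolding neighbours_eq[OF assms]
proof (rule sum.UNION_disjoint)
  let ?C = "{c \<in> level_cells (Suc n). x \<in> c}"
  show "\<forall>c\<in>?C. finite (c - {x})"
    using finite_level_cell by blast
  show "\<forall>c\<in>?C. \<forall>d\<in>?C. c \<noteq> d \<longrightarrow> (c - {x}) \<inter> (d - {x}) = {}"
  proof (intro ballI impI)
    fix c d assume cd: "c \<in> ?C" "d \<in> ?C" "c \<noteq> d"
    obtain p q where pq: "c = up_triangle p" "d = up_triangle q"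
      using cd level_cells_up_triangle by blast
    have "y \<notin> d" if "y \<in> c" "y \<noteq> x" for y
    proof
      assume "y \<in> d"
      have "p = q"
        by (rule up_triangles_share_at_most_one_vertex[of y p x q])
           (use cd(1,2) pq that \<open>y \<in> d\<close> in simp_all)
      then show False using cd(3) pq by simp
    qed
    then show "(c - {x}) \<inter> (d - {x}) = {}" by blast
  qed
qed simp

lemma finite_neighbours [simp]: "x \<in> SG_level n \<Longrightarrow> finite (neighbours x)"
  unfolding neighbours_eq using finite_level_cell by (intro finite_UN_I) auto

lemma card_neighbours:
  assumes "x \<in> SG_level n"
  shows "card (neighbours x) = 4"
proof -
  have "card (c - {x}) = 2" if "c \<in> level_cells (Suc n)" "x \<in> c" for c
    using level_cells_up_triangle[OF that(1)] that(2) by (auto simp: card_Diff_singleton)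
  moreover have "card {c \<in> level_cells (Suc n). x \<in> c} = 2"
    using SG_level_mono[of n "Suc n"] outer_corners_escape[OF assms] assms
    by (intro card_cells_at_vertex) auto
  moreover have "real (card (neighbours x)) = (\<Sum>c\<in>{c \<in> level_cells (Suc n). x \<in> c}. real (card (c - {x})))"
    using sum_neighbours[OF assms, of "\<lambda>_. 1"] by simp
  ultimately have "real (card (neighbours x)) = 4" by simp
  then show ?thesis by simp
qed

text \<open>The two cells at a vertex are distinct, so the vertex cannot be the top of both; the top of the
other cell is a neighbour one step higher.\<close>

lemma neighbour_above:
  assumes "x \<in> SG_level n"
  shows "\<exists>y\<in>neighbours x. coord2 y = coord2 x + 1"
proof -
  have "card {c \<in> level_cells (Suc n). x \<in> c} = 2"
    using SG_level_mono[of n "Suc n"] outer_corners_escape[OF assms] assms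
    by (intro card_cells_at_vertex) auto
  then obtain c d where cd: "{c \<in> level_cells (Suc n). x \<in> c} = {c, d}" "c \<noteq> d"
    by (auto simp: card_2_iff)
  then have mem: "c \<in> level_cells (Suc n)" "x \<in> c" "d \<in> level_cells (Suc n)" "x \<in> d" by blast+
  obtain p q where pq: "c = up_triangle p" "d = up_triangle q"
    using mem level_cells_up_triangle by blast
  then have "x \<noteq> p + top_corner 0 \<or> x \<noteq> q + top_corner 0"
    using cd(2) by auto
  then obtain e r where e: "e \<in> {c \<in> level_cells (Suc n). x \<in> c}" "e = up_triangle r" "x \<noteq> r + top_corner 0"
    using mem pq by blast
  then have "r + top_corner 0 \<in> neighbours x"
    unfolding neighbours_eq[OF assms] by (auto simp: up_triangle_def)
  moreover have "coord2 (r + top_corner 0) = coord2 x + 1"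
    using e by (auto simp: up_triangle_def)
  ultimately show ?thesis by blast
qed

section \<open>Stabilization on finite levels\<close>

lemma sum_topple:
  fixes g :: "point \<Rightarrow> real"
  assumes "x \<in> SG_level n" "unstable \<sigma> x"
  shows "(\<Sum>y\<in>SG_level n. g y * topple x \<sigma> y)
    = (\<Sum>y\<in>SG_level n. g y * \<sigma> y) + (\<Sum>y\<in>neighbours x \<inter> SG_level n. g y) - 4 * g x"
proof -
  have "g y * topple x \<sigma> y = g y * \<sigma> y + (if y \<in> neighbours x then g y else 0) - (if y = x then 4 * g y else 0)"
    for y
    using assms(2) by (simp add: topple_eq neighbours_def unstable_def algebra_simps of_nat_diff)
  then have "(\<Sum>y\<in>SG_level n. g y * topple x \<sigma> y)
    = (\<Sum>y\<in>SG_level n. g y * \<sigma> y) + (\<Sum>y\<in>SG_level n. if y \<in> neighbours x then g y else 0)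
      - (\<Sum>y\<in>SG_level n. if y = x then 4 * g y else 0)"
    by (simp add: sum.distrib sum_subtractf)
  also have "(\<Sum>y\<in>SG_level n. if y = x then 4 * g y else 0) = 4 * g x"
    using assms(1) by simp
  also have "(\<Sum>y\<in>SG_level n. if y \<in> neighbours x then g y else 0) = (\<Sum>y\<in>neighbours x \<inter> SG_level n. g y)"
    by (simp add: sum.inter_restrict Int_commute[of "neighbours x"])
  finally show ?thesis .
qed

lemma coord2_SG_level:
  assumes "x \<in> SG_level n"
  shows "0 \<le> coord2 x" "coord2 x \<le> 2 ^ n"
proof -
  have *: "0 \<le> coord2 y \<and> coord2 y \<le> 2 ^ n" if "y \<in> V n" for y
    using V_bounds[OF that] by simp
  have "x \<in> V n \<or> reflect x \<in> V n"
    using assms by (auto simp: SG_level_def)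
  then have "0 \<le> coord2 x \<and> coord2 x \<le> 2 ^ n"
    using *[of x] *[of "reflect x"] by auto
  then show "0 \<le> coord2 x" "coord2 x \<le> 2 ^ n" by auto
qed

text \<open>Toppling on a finite level terminates because every vertex has a neighbour one step higher. The weight
\<open>8^(2^n + 1) - 8^height\<close>, cut off at 0, decreases in the height at a geometrically growing rate, and this makes it
strictly superharmonic: the loss towards the upper neighbour outweighs any gain at the three others. Chips that
leave the level count as lost, so the total weight strictly drops with every toppling.\<close>

theorem ex_stabilizing_topplings: "\<exists>xs. stabilizing_topplings n \<sigma> xs"
proof -
  define K :: real where "K = 8 powr (2 ^ n + 1)"
  define g where "g y = K - 8 powr coord2 y" for y
  have g_nonneg: "g y \<ge> 0" if "coord2 y \<le> 2 ^ n + 1" for y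
    unfolding g_def K_def using that by (simp add: powr_mono)
  have K_nonneg: "K \<ge> 0" by (simp add: K_def)
  have g_le: "g y \<le> K" for y by (simp add: g_def)
  show ?thesis
  proof (rule ex_stabilizing_if_potential[where \<Phi>="\<lambda>\<sigma>. \<Sum>y\<in>SG_level n. max 0 (g y) * \<sigma> y"])
    show "(\<Sum>y\<in>SG_level n. max 0 (g y) * real (\<sigma> y)) \<ge> 0" for \<sigma>
      by (intro sum_nonneg) simp
    fix \<sigma> x assume x: "x \<in> SG_level n" "unstable \<sigma> x"
    obtain z where z: "z \<in> neighbours x" "coord2 z = coord2 x + 1"
      using neighbour_above[OF x(1)] by blast
    have gx: "g x = K - 8 powr coord2 x" "g z = K - 8 * 8 powr coord2 x"
      by (simp_all add: g_def z powr_add)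
    have max_x: "max 0 (g x) = g x" and max_z: "max 0 (g z) = g z"
      using g_nonneg[of x] g_nonneg[of z] coord2_SG_level[OF x(1)] z by simp_all
    \<comment> \<open>The upper neighbour may lie outside the level; its weight is nonnegative there, too, as
      its height is at most \<open>2^n + 1\<close>.\<close>
    have "(\<Sum>y\<in>neighbours x \<inter> SG_level n. max 0 (g y)) \<le> (\<Sum>y\<in>neighbours x. max 0 (g y))"
      using x by (intro sum_mono2) auto
    also have "\<dots> = max 0 (g z) + (\<Sum>y\<in>neighbours x - {z}. max 0 (g y))"
      using x z by (intro sum.remove) auto
    also have "(\<Sum>y\<in>neighbours x - {z}. max 0 (g y)) \<le> (\<Sum>y\<in>neighbours x - {z}. K)"
      by (intro sum_mono) (simp add: g_le K_nonneg)
    also have "(\<Sum>y\<in>neighbours x - {z}. K) = 3 * K"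
      using z card_neighbours[OF x(1)] by (simp add: card_Diff_singleton)
    finally have "(\<Sum>y\<in>neighbours x \<inter> SG_level n. max 0 (g y)) - 4 * max 0 (g x) \<le> - 4 * 8 powr coord2 x"
      using max_x max_z gx by linarith
    moreover have "8 powr coord2 x \<ge> 1"
      using coord2_SG_level[OF x(1)] by (simp add: ge_one_powr_ge_zero)
    ultimately show "(\<Sum>y\<in>SG_level n. max 0 (g y) * real (topple x \<sigma> y))
        \<le> (\<Sum>y\<in>SG_level n. max 0 (g y) * real (\<sigma> y)) - 1"
      unfolding sum_topple[OF x, of "\<lambda>y. max 0 (g y)"] by linarith
  qed
qed

section \<open>The odometer at the origin\<close>

text \<open>The function on the level that is 1 at the origin, 0 at the four outer corners and harmonic elsewhere: the Green
function with pole at the origin, scaled to height 1.\<close>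

definition green :: "nat \<Rightarrow> point \<Rightarrow> real" where
  "green n x = (if x \<in> V n then harmonic n 1 0 0 x else harmonic n 1 0 0 (reflect x))"

lemma green_V:
  assumes "x \<in> V n"
  shows "green n x = harmonic n 1 0 0 x" "green n (reflect x) = harmonic n 1 0 0 x"
proof -
  have "x = 0" if "reflect x \<in> V n"
  proof -
    have "x \<in> V n \<inter> reflect ` V n" using that assms by (simp add: reflect_mem_iff)
    then show ?thesis by (simp add: V_halves_meet)
  qed
  then show "green n x = harmonic n 1 0 0 x" "green n (reflect x) = harmonic n 1 0 0 x"
    using assms by (auto simp: green_def)
qed

lemma green_bounds: "0 \<le> green n x" "green n x \<le> 1"
  by (simp_all add: green_def harmonic_bounds(1)[where h=1] harmonic_bounds(2)[where l=0])

lemma green_outer_corners: "x \<in> outer_corners n \<Longrightarrow> green n x = 0"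
  by (auto simp: outer_corners_def green_V)

text \<open>By the 1/5-2/5 rule the function has value 2/5 at the outer corners of the previous level, and the maximum principle
transfers this bound to the interior.\<close>

lemma green_ge_inner:
  assumes "x \<in> SG_level n"
  shows "green (Suc n) x \<ge> 2 / 5"
proof -
  have *: "harmonic (Suc n) 1 0 0 y \<ge> 2 / 5" if "y \<in> V n" for y
    unfolding harmonic_pieces(1)[OF that] by (rule harmonic_bounds(1)[where h=1]) simp_all
  have V: "y \<in> V (Suc n)" if "y \<in> V n" for y
    using that by (simp add: V_Suc)
  show ?thesis
    using assms unfolding SG_level_def
  proof
    assume "x \<in> V n"
    then show ?thesis using * V green_V(1) by simp
  next
    assume "x \<in> reflect ` V n"
    then obtain y where "y \<in> V n" "x = reflect y" by blast
    then show ?thesis using * V green_V(2) by simp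
  qed
qed

lemma green_laplacian:
  assumes "x \<notin> outer_corners n"
  shows "(\<Sum>c\<in>{c\<in>level_cells n. x \<in> c}. \<Sum>y\<in>c. green n x - green n y)
    = (if x = 0 then 4 * (3 / 5) ^ n else 0)"
proof -
  have inV: "y \<in> V n" if "c \<in> cells n" "y \<in> c" for c y
    using that Union_cells by blast
  let ?u = "indicator {x} :: point \<Rightarrow> real"
  have "(\<Sum>c\<in>{c\<in>level_cells n. x \<in> c}. \<Sum>y\<in>c. green n x - green n y)
    = (\<Sum>c\<in>level_cells n. \<Sum>z\<in>c. \<Sum>y\<in>c. ?u z * (green n z - green n y))"
    by (subst sum_cells_indicator[of x "\<lambda>z c. \<Sum>y\<in>c. green n z - green n y" n, symmetric])
       (simp add: sum_distrib_left)
  also have "\<dots> = (\<Sum>c\<in>cells n. \<Sum>z\<in>c. \<Sum>y\<in>c. ?u z * (harmonic n 1 0 0 z - harmonic n 1 0 0 y))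
    + (\<Sum>c\<in>cells n. \<Sum>z\<in>c. \<Sum>y\<in>c. ?u (reflect z) * (harmonic n 1 0 0 z - harmonic n 1 0 0 y))"
    unfolding sum_level_cells
    by (rule arg_cong2[where f="(+)"]; rule sum.cong[OF refl])
       (simp_all add: sum.reindex green_V inV cong: sum.cong)
  also have "\<dots> = (3 / 5) ^ n * (2 * ?u 0 - ?u (right_corner n) - ?u (top_corner n))
    + (3 / 5) ^ n * (2 * ?u 0 - ?u (reflect (right_corner n)) - ?u (reflect (top_corner n)))"
    unfolding harmonic_green by (simp add: algebra_simps)
  also have "\<dots> = (if x = 0 then 4 * (3 / 5) ^ n else 0)"
    using assms by (auto simp: outer_corners_def indicator_def)
  finally show ?thesis .
qed

text \<open>Bounds from below the change of the Green-weighted number of chips when \<open>x\<close> topples. An outer corner carries weight 0 and so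
has nothing to lose; at all other vertices both cells belong to the level, so no chip leaves it and
the change is the Laplacian.\<close>

lemma green_neighbours:
  assumes "x \<in> SG_level n"
  shows "(\<Sum>y\<in>neighbours x \<inter> SG_level n. green n y) - 4 * green n x
    \<ge> (if x = 0 then - 4 * (3 / 5) ^ n else 0)"
proof (cases "x \<in> outer_corners n")
  case True
  moreover have "0 \<notin> outer_corners n"
    by (auto simp: outer_corners_def point_eq_iff)
  ultimately show ?thesis
    using green_outer_corners by (auto intro!: sum_nonneg green_bounds)
next
  case False
  let ?C = "{c \<in> level_cells (Suc n). x \<in> c}"
  have "card ?C = 2"
    using SG_level_mono[of n "Suc n"] outer_corners_escape[OF assms] assms
    by (intro card_cells_at_vertex) auto
  then have C: "?C = {c \<in> level_cells n. x \<in> c}"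
    using card_cells_at_vertex[OF assms False] level_cells_mono[of n "Suc n"]
    by (intro card_subset_eq[symmetric]) auto
  have "neighbours x \<subseteq> SG_level n"
    unfolding neighbours_eq[OF assms] C using Union_level_cells by blast
  then have "neighbours x \<inter> SG_level n = neighbours x" by blast
  moreover have "4 * green n x = (\<Sum>y\<in>neighbours x. green n x)"
    using card_neighbours[OF assms] by simp
  ultimately have "(\<Sum>y\<in>neighbours x \<inter> SG_level n. green n y) - 4 * green n x
    = (\<Sum>y\<in>neighbours x. green n y - green n x)"
    by (simp only: sum_subtractf)
  also have "\<dots> = (\<Sum>c\<in>?C. \<Sum>y\<in>c - {x}. green n y - green n x)"
    by (rule sum_neighbours[OF assms])
  also have "\<dots> = (\<Sum>c\<in>?C. - (\<Sum>y\<in>c. green n x - green n y))"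
  proof (rule sum.cong[OF refl])
    fix c assume c: "c \<in> ?C"
    then have "finite c" using finite_level_cell by blast
    then have "(\<Sum>y\<in>c. green n y - green n x) = (\<Sum>y\<in>c - {x}. green n y - green n x)"
      using c by (subst sum.remove[of c x]) auto
    then show "(\<Sum>y\<in>c - {x}. green n y - green n x) = - (\<Sum>y\<in>c. green n x - green n y)"
      by (simp flip: sum_negf)
  qed
  also have "\<dots> = - (\<Sum>c\<in>{c \<in> level_cells n. x \<in> c}. \<Sum>y\<in>c. green n x - green n y)"
    unfolding C by (rule sum_negf)
  also have "\<dots> = (if x = 0 then - 4 * (3 / 5) ^ n else 0)"
    unfolding green_laplacian[OF False] by simp
  finally show ?thesis by simp
qed

lemma green_mass_le:
  assumes "legal_topplings n \<sigma> xs"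
  shows "(\<Sum>y\<in>SG_level n. green n y * \<sigma> y) - 4 * (3 / 5) ^ n * count_list xs 0
    \<le> (\<Sum>y\<in>SG_level n. green n y * fold topple xs \<sigma> y)"
  using assms
proof (induction xs arbitrary: \<sigma>)
  case (Cons x xs)
  then have x: "x \<in> SG_level n" "unstable \<sigma> x" by simp_all
  have "(\<Sum>y\<in>SG_level n. green n y * \<sigma> y) + (if x = 0 then - 4 * (3 / 5) ^ n else 0)
      \<le> (\<Sum>y\<in>SG_level n. green n y * topple x \<sigma> y)"
    using green_neighbours[OF x(1)] unfolding sum_topple[OF x] by linarith
  moreover have "(\<Sum>y\<in>SG_level n. green n y * topple x \<sigma> y) - 4 * (3 / 5) ^ n * count_list xs 0
    \<le> (\<Sum>y\<in>SG_level n. green n y * fold topple xs (topple x \<sigma>) y)"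
    using Cons by simp
  ultimately show ?case
    by (cases "x = 0") (simp_all add: algebra_simps)
qed simp

text \<open>Only topplings of the origin lower the weighted number of chips, each by at most \<open>4 (3/5)^n\<close>, and at the end at
most 3 chips are left at each vertex. So any weighted excess over 3 forces topplings at the origin.\<close>

theorem odometer_origin_ge:
  "(\<Sum>y\<in>SG_level n. green n y * (real (\<sigma> y) - 3)) \<le> (3 / 5) ^ n * odometer n \<sigma> 0"
proof -
  obtain xs where xs: "stabilizing_topplings n \<sigma> xs"
    using ex_stabilizing_topplings by blast
  then have legal: "legal_topplings n \<sigma> xs" and stable: "\<And>y. y \<in> SG_level n \<Longrightarrow> fold topple xs \<sigma> y \<le> 3"
    by (auto simp: stabilizing_topplings_def unstable_def not_le)
  have "(\<Sum>y\<in>SG_level n. green n y * fold topple xs \<sigma> y) \<le> (\<Sum>y\<in>SG_level n. green n y * 3)"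
    using stable by (intro sum_mono mult_left_mono green_bounds) fastforce
  then show ?thesis
    using green_mass_le[OF legal] odometer_eq[OF xs, of 0]
    by (simp add: right_diff_distrib sum_subtractf)
qed

lemma card_SG_level: "n \<le> card (SG_level n)"
proof -
  have "card (V n) \<ge> n"
  proof (induction n)
    case (Suc n)
    have "right_corner (Suc n) \<notin> V n"
      using V_bounds(3)[of "right_corner (Suc n)" n] by auto
    then have "card (insert (right_corner (Suc n)) (V n)) = Suc (card (V n))" by simp
    moreover have "insert (right_corner (Suc n)) (V n) \<subseteq> V (Suc n)"
      using V_mono[of n "Suc n"] by simp
    ultimately show ?case
      using Suc card_mono[OF finite_V] by (metis Suc_le_mono order_trans)
  qed simp
  then show ?thesis
    by (rule order_trans) (auto intro!: card_mono simp: SG_level_def)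
qed

section \<open>Unboundedness of weighted sums\<close>

text \<open>Compares a Gaussian factor with its second-order expansion, to be matched with the same expansion of
a characteristic function.\<close>

lemma exp_minus_approx:
  fixes v :: real
  assumes "v \<ge> 0"
  shows "\<bar>exp (- v) - (1 - v)\<bar> \<le> v\<^sup>2"
proof -
  have "1 - v \<le> exp (- v)"
    using exp_ge_add_one_self[of "- v"] by simp
  moreover have "exp (- v) \<le> 1 / (1 + v)"
    using exp_ge_add_one_self[of v] assms by (simp add: exp_minus field_simps)
  moreover have "1 / (1 + v) \<le> 1 - v + v\<^sup>2"
  proof -
    have "1 \<le> (1 - v + v\<^sup>2) * (1 + v)"
      using assms by (simp add: algebra_simps power2_eq_square)
    then show ?thesis using assms by (simp add: divide_le_eq)
  qed
  ultimately show ?thesis by linarith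
qed

context prob_space
begin

text \<open>A central limit theorem for weighted sums of i.i.d. variables. With bounded weights whose squares have diverging sum,
every single normalized weight tends to 0, and the sum of their squares stays fixed. The
characteristic functions of the summands are then uniformly close to Gaussian ones, the error per
summand being proportional to the squared weight times a factor tending to 0.\<close>

theorem weighted_central_limit_theorem:
  fixes X :: "'i \<Rightarrow> 'a \<Rightarrow> real" and J :: "nat \<Rightarrow> 'i set" and w :: "nat \<Rightarrow> 'i \<Rightarrow> real"
  assumes indep: "indep_vars (\<lambda>_. borel) X I"
    and distr: "\<And>i. i \<in> I \<Longrightarrow> distr M borel (X i) = \<mu>"
    and \<mu>: "real_distribution \<mu>"
    and square_integrable: "integrable \<mu> (\<lambda>x. x\<^sup>2)"
    and mean: "integral\<^sup>L \<mu> (\<lambda>x. x) = 0"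
    and variance: "integral\<^sup>L \<mu> (\<lambda>x. x\<^sup>2) = s\<^sup>2" and s: "s > 0"
    and J: "\<And>n. J n \<subseteq> I" "\<And>n. finite (J n)"
    and w: "\<And>n i. \<bar>w n i\<bar> \<le> 1"
    and diverges: "filterlim (\<lambda>n. \<Sum>i\<in>J n. (w n i)\<^sup>2) at_top sequentially"
  shows "weak_conv_m
    (\<lambda>n. distr M borel (\<lambda>\<omega>. (\<Sum>i\<in>J n. w n i * X i \<omega>) / (s * sqrt (\<Sum>i\<in>J n. (w n i)\<^sup>2))))
    std_normal_distribution"
proof -
  interpret \<mu>: real_distribution \<mu> by fact
  define B where "B n = sqrt (\<Sum>i\<in>J n. (w n i)\<^sup>2)" for n
  define c where "c n i = w n i / (s * B n)" for n i
  define m where "m r = (LINT x|\<mu>. min (6 * x\<^sup>2) (r * \<bar>x\<bar> ^ 3))" for r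
  have rv[measurable]: "i \<in> I \<Longrightarrow> X i \<in> borel_measurable M" for i
    using indep unfolding indep_vars_def2 by simp
  have rvJ[measurable]: "i \<in> J n \<Longrightarrow> X i \<in> borel_measurable M" for i n
    using J by (intro rv) auto
  have B_top: "filterlim B at_top sequentially"
    unfolding B_def by (rule filterlim_compose[OF sqrt_at_top diverges])
  have \<mu>_integrable: "integrable \<mu> (\<lambda>x. x)"
    by (rule \<mu>.square_integrable_imp_integrable[OF _ square_integrable]) simp
  have int_min: "integrable \<mu> (\<lambda>x. min (6 * x\<^sup>2) (r * \<bar>x\<bar> ^ 3))" if "r \<ge> 0" for r
    by (rule Bochner_Integration.integrable_bound[where f="\<lambda>x. 6 * x\<^sup>2"])
       (use that in \<open>auto simp: square_integrable min_def\<close>)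
  have char_eq: "char (distr M borel (\<lambda>\<omega>. (\<Sum>i\<in>J n. w n i * X i \<omega>) / (s * B n))) t
      = (\<Prod>i\<in>J n. char \<mu> (t * c n i))" for n t
  proof -
    have "(\<lambda>\<omega>. (\<Sum>i\<in>J n. w n i * X i \<omega>) / (s * B n)) = (\<lambda>\<omega>. \<Sum>i\<in>J n. c n i * X i \<omega>)"
      by (simp add: c_def sum_divide_distrib)
    then have "char (distr M borel (\<lambda>\<omega>. (\<Sum>i\<in>J n. w n i * X i \<omega>) / (s * B n))) t
        = char (distr M borel (\<lambda>\<omega>. \<Sum>i\<in>J n. c n i * X i \<omega>)) t" by simp
    also have "\<dots> = (\<Prod>i\<in>J n. char (distr M borel (\<lambda>\<omega>. c n i * X i \<omega>)) t)"
      by (rule char_distr_sum,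
          rule indep_vars_compose2[OF indep_vars_subset[OF indep J(1)], where Y="\<lambda>i x. c n i * x"]) simp
    also have "\<dots> = (\<Prod>i\<in>J n. char \<mu> (t * c n i))"
    proof (rule prod.cong)
      fix i assume i: "i \<in> J n"
      then have "i \<in> I" using J by auto
      show "char (distr M borel (\<lambda>\<omega>. c n i * X i \<omega>)) t = char \<mu> (t * c n i)"
        unfolding char_def distr[OF \<open>i \<in> I\<close>, symmetric] using \<open>i \<in> I\<close>
        by (simp add: integral_distr mult_ac)
    qed simp
    finally show ?thesis .
  qed
  have main: "norm ((\<Prod>i\<in>J n. char \<mu> (t * c n i)) - exp (- (t\<^sup>2) / 2))
      \<le> t\<^sup>2 / (6 * s\<^sup>2) * m (\<bar>t\<bar> / (s * B n)) + t^4 / (4 * (B n)\<^sup>2)" if Bn: "B n > 0" for n t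
  proof -
    define v where "v i = (t * c n i)\<^sup>2 * s\<^sup>2 / 2" for i
    have B2: "(B n)\<^sup>2 = (\<Sum>i\<in>J n. (w n i)\<^sup>2)"
      unfolding B_def by (simp add: sum_nonneg)
    have sum_c: "(\<Sum>i\<in>J n. (c n i)\<^sup>2) = 1 / s\<^sup>2"
      using Bn s by (simp add: c_def power_divide power_mult_distrib
          flip: sum_divide_distrib B2)
    have sum_v: "(\<Sum>i\<in>J n. v i) = t\<^sup>2 / 2"
    proof -
      have "(\<Sum>i\<in>J n. v i) = (t\<^sup>2 * s\<^sup>2 / 2) * (\<Sum>i\<in>J n. (c n i)\<^sup>2)"
        unfolding v_def by (simp add: sum_distrib_left power_mult_distrib mult_ac)
      then show ?thesis using s by (simp add: sum_c)
    qed
    have c_le: "\<bar>c n i\<bar> \<le> 1 / (s * B n)" for i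
      using w[of n i] s Bn by (simp add: c_def abs_mult divide_right_mono)
    have m_mono: "(LINT x|\<mu>. min (6 * x\<^sup>2) (\<bar>t * c n i\<bar> * \<bar>x\<bar> ^ 3)) \<le> m (\<bar>t\<bar> / (s * B n))" for i
      unfolding m_def
    proof (rule integral_mono)
      fix x
      have "\<bar>t * c n i\<bar> \<le> \<bar>t\<bar> / (s * B n)"
        using mult_left_mono[OF c_le[of i], of "\<bar>t\<bar>"] by (simp add: abs_mult)
      then show "min (6 * x\<^sup>2) (\<bar>t * c n i\<bar> * \<bar>x\<bar> ^ 3) \<le> min (6 * x\<^sup>2) (\<bar>t\<bar> / (s * B n) * \<bar>x\<bar> ^ 3)"
        by (intro min.mono mult_right_mono) auto
    next
      show "integrable \<mu> (\<lambda>x. min (6 * x\<^sup>2) (\<bar>t\<bar> / (s * B n) * \<bar>x\<bar> ^ 3))"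
        using s Bn by (intro int_min) simp
    qed (simp add: int_min)
    have v_le: "v i \<le> t\<^sup>2 / (2 * (B n)\<^sup>2)" and v_ge: "v i \<ge> 0" for i
    proof -
      have "(c n i)\<^sup>2 \<le> (1 / (s * B n))\<^sup>2"
        using c_le[of i] power_mono[of "\<bar>c n i\<bar>" "1 / (s * B n)" 2] by simp
      then have "t\<^sup>2 * s\<^sup>2 / 2 * (c n i)\<^sup>2 \<le> t\<^sup>2 * s\<^sup>2 / 2 * (1 / (s * B n))\<^sup>2"
        by (intro mult_left_mono) auto
      then show "v i \<le> t\<^sup>2 / (2 * (B n)\<^sup>2)"
        using s by (simp add: v_def power_mult_distrib power_divide mult_ac)
    qed (simp add: v_def)
    have "complex_of_real (exp (- (t\<^sup>2) / 2)) = (\<Prod>i\<in>J n. complex_of_real (exp (- v i)))"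
      using sum_v by (simp add: exp_sum[OF J(2), symmetric] sum_negf flip: of_real_prod)
    then have "norm ((\<Prod>i\<in>J n. char \<mu> (t * c n i)) - exp (- (t\<^sup>2) / 2))
        = norm ((\<Prod>i\<in>J n. char \<mu> (t * c n i)) - (\<Prod>i\<in>J n. complex_of_real (exp (- v i))))"
      by simp
    also have "\<dots> \<le> (\<Sum>i\<in>J n. norm (char \<mu> (t * c n i) - complex_of_real (exp (- v i))))"
      by (rule norm_prod_diff) (auto simp: \<mu>.cmod_char_le_1 v_ge)
    also have "\<dots> \<le> (\<Sum>i\<in>J n. (t * c n i)\<^sup>2 / 6 * m (\<bar>t\<bar> / (s * B n)) + v i * (t\<^sup>2 / (2 * (B n)\<^sup>2)))"
    proof (rule sum_mono)
      fix i
      have "norm (char \<mu> (t * c n i) - (1 - complex_of_real (v i)))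
          \<le> (t * c n i)\<^sup>2 / 6 * (LINT x|\<mu>. min (6 * x\<^sup>2) (\<bar>t * c n i\<bar> * \<bar>x\<bar> ^ 3))"
        using \<mu>.char_approx3[OF \<mu>_integrable mean square_integrable, of "s\<^sup>2" "t * c n i"] variance mean
        by (simp add: v_def)
      also have "\<dots> \<le> (t * c n i)\<^sup>2 / 6 * m (\<bar>t\<bar> / (s * B n))"
        by (intro mult_left_mono m_mono) simp
      finally have 1: "norm (char \<mu> (t * c n i) - (1 - complex_of_real (v i)))
          \<le> (t * c n i)\<^sup>2 / 6 * m (\<bar>t\<bar> / (s * B n))" .
      have "norm ((1 - complex_of_real (v i)) - complex_of_real (exp (- v i))) = \<bar>exp (- v i) - (1 - v i)\<bar>"
        by (metis abs_minus_commute norm_of_real of_real_1 of_real_diff)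
      also have "\<dots> \<le> (v i)\<^sup>2"
        by (rule exp_minus_approx[OF v_ge])
      also have "\<dots> \<le> v i * (t\<^sup>2 / (2 * (B n)\<^sup>2))"
        unfolding power2_eq_square[of "v i"] by (intro mult_left_mono v_le v_ge)
      finally have 2: "norm ((1 - complex_of_real (v i)) - complex_of_real (exp (- v i)))
          \<le> v i * (t\<^sup>2 / (2 * (B n)\<^sup>2))" .
      show "norm (char \<mu> (t * c n i) - complex_of_real (exp (- v i)))
          \<le> (t * c n i)\<^sup>2 / 6 * m (\<bar>t\<bar> / (s * B n)) + v i * (t\<^sup>2 / (2 * (B n)\<^sup>2))"
        using norm_triangle_le[OF add_mono[OF 1 2]] by simp
    qed
    also have "\<dots> = t\<^sup>2 / 6 * m (\<bar>t\<bar> / (s * B n)) * (\<Sum>i\<in>J n. (c n i)\<^sup>2)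
        + (\<Sum>i\<in>J n. v i) * (t\<^sup>2 / (2 * (B n)\<^sup>2))"
      by (simp add: sum.distrib sum_distrib_left[symmetric] sum_distrib_right[symmetric] sum_divide_distrib[symmetric] power_mult_distrib mult_ac)
    also have "\<dots> = t\<^sup>2 / (6 * s\<^sup>2) * m (\<bar>t\<bar> / (s * B n)) + t^4 / (4 * (B n)\<^sup>2)"
      by (simp add: sum_c sum_v)
    finally show ?thesis .
  qed
  show ?thesis
    unfolding B_def[symmetric]
  proof (rule levy_continuity)
    fix t
    have r_lim: "(\<lambda>n. \<bar>t\<bar> / (s * B n)) \<longlonglongrightarrow> 0"
      using s B_top by (intro real_tendsto_divide_at_top[OF tendsto_const] filterlim_tendsto_pos_mult_at_top[OF tendsto_const])
    have ev: "eventually (\<lambda>n. B n > 0) sequentially"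
      using B_top by (simp add: filterlim_at_top_dense)
    have B_nonneg: "B n \<ge> 0" for n
      unfolding B_def by (simp add: sum_nonneg)
    have "(\<lambda>n. m (\<bar>t\<bar> / (s * B n))) \<longlonglongrightarrow> (LINT x|\<mu>. 0)"
      unfolding m_def
    proof (rule integral_dominated_convergence[where w="\<lambda>x. 6 * x\<^sup>2"])
      show "AE x in \<mu>. (\<lambda>n. min (6 * x\<^sup>2) (\<bar>t\<bar> / (s * B n) * \<bar>x\<bar> ^ 3)) \<longlonglongrightarrow> 0"
      proof (rule AE_I2)
        fix x
        have "(\<lambda>n. min (6 * x\<^sup>2) (\<bar>t\<bar> / (s * B n) * \<bar>x\<bar> ^ 3)) \<longlonglongrightarrow> min (6 * x\<^sup>2) (0 * \<bar>x\<bar> ^ 3)"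
          by (intro tendsto_intros r_lim)
        then show "(\<lambda>n. min (6 * x\<^sup>2) (\<bar>t\<bar> / (s * B n) * \<bar>x\<bar> ^ 3)) \<longlonglongrightarrow> 0"
          by (simp add: min_absorb2)
      qed
    next
      show "AE x in \<mu>. norm (min (6 * x\<^sup>2) (\<bar>t\<bar> / (s * B n) * \<bar>x\<bar> ^ 3)) \<le> 6 * x\<^sup>2" for n
        using s B_nonneg[of n] by (intro AE_I2) (simp add: min_def)
    qed (simp_all add: square_integrable)
    then have m_lim: "(\<lambda>n. m (\<bar>t\<bar> / (s * B n))) \<longlonglongrightarrow> 0" by simp
    have B2_top: "filterlim (\<lambda>n. 4 * (B n)\<^sup>2) at_top sequentially"
      by (intro filterlim_tendsto_pos_mult_at_top[OF tendsto_const] filterlim_pow_at_top B_top) auto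
    have "(\<lambda>n. t\<^sup>2 / (6 * s\<^sup>2) * m (\<bar>t\<bar> / (s * B n)) + t^4 / (4 * (B n)\<^sup>2))
        \<longlonglongrightarrow> t\<^sup>2 / (6 * s\<^sup>2) * 0 + 0"
      by (intro tendsto_add tendsto_mult tendsto_const m_lim real_tendsto_divide_at_top[OF tendsto_const B2_top])
    then have error_lim:
      "(\<lambda>n. t\<^sup>2 / (6 * s\<^sup>2) * m (\<bar>t\<bar> / (s * B n)) + t^4 / (4 * (B n)\<^sup>2)) \<longlonglongrightarrow> 0"
      by simp
    have "(\<lambda>n. (\<Prod>i\<in>J n. char \<mu> (t * c n i)) - exp (- (t\<^sup>2) / 2)) \<longlonglongrightarrow> 0"
      by (rule Lim_null_comparison[OF eventually_mono[OF ev main] error_lim])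
    then show "(\<lambda>n. char (distr M borel (\<lambda>\<omega>. (\<Sum>i\<in>J n. w n i * X i \<omega>) / (s * B n))) t)
        \<longlonglongrightarrow> char std_normal_distribution t"
      unfolding char_eq char_std_normal_distribution by (simp add: LIM_zero_iff)
  qed (auto intro!: real_dist_normal_dist)
qed

text \<open>A standard normal variable exceeds 1 with positive probability, so the weighted sums exceed their standard
deviation with probability bounded away from 0.\<close>

lemma weighted_sum_exceeds_deviation:
  fixes X :: "'i \<Rightarrow> 'a \<Rightarrow> real" and J :: "nat \<Rightarrow> 'i set" and w :: "nat \<Rightarrow> 'i \<Rightarrow> real"
  assumes indep: "indep_vars (\<lambda>_. borel) X I"
    and distr: "\<And>i. i \<in> I \<Longrightarrow> distr M borel (X i) = \<mu>"
    and \<mu>: "real_distribution \<mu>"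
    and square_integrable: "integrable \<mu> (\<lambda>x. x\<^sup>2)"
    and mean: "integral\<^sup>L \<mu> (\<lambda>x. x) = 0"
    and variance: "integral\<^sup>L \<mu> (\<lambda>x. x\<^sup>2) = s\<^sup>2" and s: "s > 0"
    and J: "\<And>n. J n \<subseteq> I" "\<And>n. finite (J n)"
    and w: "\<And>n i. \<bar>w n i\<bar> \<le> 1"
    and diverges: "filterlim (\<lambda>n. \<Sum>i\<in>J n. (w n i)\<^sup>2) at_top sequentially"
  obtains \<delta> where "\<delta> > 0"
    "eventually (\<lambda>n. prob {\<omega>\<in>space M. (\<Sum>i\<in>J n. w n i * X i \<omega>) > s * sqrt (\<Sum>i\<in>J n. (w n i)\<^sup>2)} \<ge> \<delta>)
      sequentially"
proof -
  define B where "B n = sqrt (\<Sum>i\<in>J n. (w n i)\<^sup>2)" for n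
  define Z where "Z n \<omega> = (\<Sum>i\<in>J n. w n i * X i \<omega>) / (s * B n)" for n \<omega>
  interpret N: real_distribution std_normal_distribution
    by (rule real_dist_normal_dist)
  have rvJ[measurable]: "i \<in> J n \<Longrightarrow> X i \<in> borel_measurable M" for i n
    using J indep unfolding indep_vars_def2 by auto
  have Z[measurable]: "Z n \<in> borel_measurable M" for n
    unfolding Z_def by measurable
  have "AE x in lborel. x \<noteq> (1 :: real)"
    by (rule AE_lborel_singleton)
  then have "AE x in std_normal_distribution. x \<noteq> 1"
    by (subst AE_density) auto
  then have "N.prob {1} = 0"
    by (subst (asm) AE_iff_measurable[where N="{1}"]) (auto simp: N.emeasure_eq_measure)
  then have cont: "isCont (cdf std_normal_distribution) 1"
    by (simp add: N.isCont_cdf)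
  have "N.prob {1<..} \<noteq> 0"
  proof
    assume "N.prob {1<..} = 0"
    then have "AE x in std_normal_distribution. x \<le> 1"
      by (subst AE_iff_measurable[where N="{1<..}"]) (auto simp: N.emeasure_eq_measure not_le)
    then have "AE x in lborel. x \<le> (1 :: real)"
      by (subst (asm) AE_density) (auto simp: normal_density_pos)
    then have "emeasure lborel {1<..2::real} \<le> emeasure lborel ({}::real set)"
      by (intro emeasure_mono_AE) auto
    then show False by simp
  qed
  then have pos: "N.prob {1<..} > 0"
    by (simp add: zero_less_measure_iff)
  have cdf_eq: "cdf (distr M borel (Z n)) 1 = 1 - prob {\<omega>\<in>space M. Z n \<omega> > 1}" for n
  proof -
    have "cdf (distr M borel (Z n)) 1 = prob {\<omega>\<in>space M. Z n \<omega> \<le> 1}"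
      by (auto simp: cdf_def2 measure_distr vimage_def Int_def intro!: arg_cong[where f=prob])
    also have "\<dots> = prob (space M - {\<omega>\<in>space M. Z n \<omega> > 1})"
      by (intro arg_cong[where f=prob]) auto
    also have "\<dots> = 1 - prob {\<omega>\<in>space M. Z n \<omega> > 1}"
      by (rule prob_compl) measurable
    finally show ?thesis .
  qed
  have cdf_N: "cdf std_normal_distribution 1 = 1 - N.prob {1<..}"
    using N.prob_compl[of "{1<..}"] by (simp add: cdf_def2 Compl_eq_Diff_UNIV[symmetric])
  have "(\<lambda>n. cdf (distr M borel (Z n)) 1) \<longlonglongrightarrow> cdf std_normal_distribution 1"
    using weighted_central_limit_theorem[OF assms] cont
    unfolding weak_conv_m_def weak_conv_def Z_def B_def by blast
  then have "(\<lambda>n. 1 - cdf (distr M borel (Z n)) 1) \<longlonglongrightarrow> N.prob {1<..}"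
    unfolding cdf_N by (auto intro!: tendsto_eq_intros)
  then have "(\<lambda>n. prob {\<omega>\<in>space M. Z n \<omega> > 1}) \<longlonglongrightarrow> N.prob {1<..}"
    by (simp add: cdf_eq)
  then have "eventually (\<lambda>n. prob {\<omega>\<in>space M. Z n \<omega> > 1} > N.prob {1<..} / 2) sequentially"
    using pos by (intro order_tendstoD) auto
  moreover have "eventually (\<lambda>n. B n > 0) sequentially"
    using filterlim_compose[OF sqrt_at_top diverges]
    unfolding B_def filterlim_at_top_dense by blast
  ultimately have "eventually (\<lambda>n. prob {\<omega>\<in>space M. (\<Sum>i\<in>J n. w n i * X i \<omega>) > s * B n}
      \<ge> N.prob {1<..} / 2) sequentially"
  proof eventually_elim
    case (elim n)
    have "{\<omega>\<in>space M. Z n \<omega> > 1} = {\<omega>\<in>space M. (\<Sum>i\<in>J n. w n i * X i \<omega>) > s * B n}"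
      using s elim(2) by (simp add: Z_def less_divide_eq)
    then show ?case using elim(1) by simp
  qed
  then show ?thesis
    using that[of "N.prob {1<..} / 2"] pos unfolding B_def by simp
qed

text \<open>By the Borel zero-one law it is enough to exclude that the events almost surely stop occurring. In that
case their indicators would tend to 0 almost surely, and so would the probabilities, by dominated convergence.\<close>

lemma infinitely_often_if_indep_and_prob_bounded_below:
  assumes indep: "indep_events (\<lambda>k. {\<omega>\<in>space M. P k \<omega>}) UNIV"
    and "\<delta> > 0" and bound: "eventually (\<lambda>k. prob {\<omega>\<in>space M. P k \<omega>} \<ge> \<delta>) sequentially"
  shows "AE \<omega> in M. infinite {k. P k \<omega>}"
proof (rule ccontr)
  assume "\<not> ?thesis"
  then have fin: "AE \<omega> in M. finite {k. P k \<omega>}"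
    using borel_0_1_law_AE[OF indep] by blast
  have [measurable]: "{\<omega>\<in>space M. P k \<omega>} \<in> sets M" for k
    using indep by (auto simp: indep_events_def)
  have "(\<lambda>k. \<integral>\<omega>. indicator {\<omega>\<in>space M. P k \<omega>} \<omega> \<partial>M) \<longlonglongrightarrow> (\<integral>\<omega>. (0::real) \<partial>M)"
  proof (rule integral_dominated_convergence[where w="\<lambda>_. 1"])
    show "AE \<omega> in M. (\<lambda>k. indicator {\<omega>\<in>space M. P k \<omega>} \<omega>) \<longlonglongrightarrow> (0::real)"
      using fin
    proof eventually_elim
      case (elim \<omega>)
      then have "eventually (\<lambda>k. \<not> P k \<omega>) sequentially"
        by (simp add: MOST_iff_cofinite eventually_cofinite cofinite_eq_sequentially[symmetric])
      then have "eventually (\<lambda>k. indicator {\<omega>\<in>space M. P k \<omega>} \<omega> = (0::real)) sequentially"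
        by eventually_elim simp
      then show ?case by (rule tendsto_eventually)
    qed
  qed (auto simp: indicator_def)
  then have "(\<lambda>k. prob {\<omega>\<in>space M. P k \<omega>}) \<longlonglongrightarrow> 0" by simp
  then have "eventually (\<lambda>k. prob {\<omega>\<in>space M. P k \<omega>} < \<delta>) sequentially"
    using \<open>\<delta> > 0\<close> by (rule order_tendstoD)
  with bound have "eventually (\<lambda>k :: nat. False) sequentially"
    by eventually_elim simp
  then show False by simp
qed

text \<open>The central limit theorem alone gives large values only with some positive probability. To get them
almost surely, pass to a sparse subsequence \<open>r\<close> of the index sets, along which the contribution \<open>Y\<close> of the new indices
dwarfs that of the old ones. The new contributions are independent, so almost surely they exceed
their standard deviation infinitely often, while the old ones, bounded by \<open>Q\<close>, eventually stay below half of
it by Markov's inequality and the Borel-Cantelli lemma. The weights may change with \<open>n\<close>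
even on old indices; \<open>Q\<close> is independent of the weights and so copes with this.\<close>

theorem weighted_sums_unbounded:
  fixes X :: "'i \<Rightarrow> 'a \<Rightarrow> real" and F :: "nat \<Rightarrow> 'i set" and w :: "nat \<Rightarrow> 'i \<Rightarrow> real"
  assumes indep: "indep_vars (\<lambda>_. borel) X I"
    and distr: "\<And>i. i \<in> I \<Longrightarrow> distr M borel (X i) = \<mu>"
    and \<mu>: "real_distribution \<mu>"
    and square_integrable: "integrable \<mu> (\<lambda>x. x\<^sup>2)"
    and mean: "integral\<^sup>L \<mu> (\<lambda>x. x) = 0"
    and variance: "integral\<^sup>L \<mu> (\<lambda>x. x\<^sup>2) = s\<^sup>2" and s: "s > 0"
    and F: "\<And>n. F n \<subseteq> I" "\<And>n. finite (F n)" "mono F"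
    and w: "\<And>n i. \<bar>w n i\<bar> \<le> 1"
    and diverges: "filterlim (\<lambda>n. \<Sum>i\<in>F n. (w n i)\<^sup>2) at_top sequentially"
  shows "AE \<omega> in M. \<forall>K. \<exists>n. (\<Sum>i\<in>F n. w n i * X i \<omega>) \<ge> K"
proof -
  interpret \<mu>: real_distribution \<mu> by fact
  have rv: "i \<in> I \<Longrightarrow> X i \<in> borel_measurable M" for i
    using indep unfolding indep_vars_def2 by simp
  have rvF[measurable]: "i \<in> F n \<Longrightarrow> X i \<in> borel_measurable M" for i n
    using F by (intro rv) auto
  have \<mu>_integrable: "integrable \<mu> (\<lambda>x. x)"
    by (rule \<mu>.square_integrable_imp_integrable[OF _ square_integrable]) simp
  define b where "b n n' = sqrt (\<Sum>i\<in>F n' - F n. (w n' i)\<^sup>2)" for n n'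
  \<comment> \<open>The old indices contribute at most their number to the sum of squares, so discarding them
    does not prevent that sum from diverging. The factor \<open>card (F n) + 1\<close> later cancels the
    expectation of \<open>Q\<close>, and \<open>2 ^ k\<close> makes the resulting bounds summable.\<close>
  have "\<exists>n'>n. b n n' \<ge> 2 ^ k * (real (card (F n)) + 1)" for n k
  proof -
    define L where "L = 2 ^ k * (real (card (F n)) + 1)"
    have "eventually (\<lambda>n'. (\<Sum>i\<in>F n'. (w n' i)\<^sup>2) \<ge> L\<^sup>2 + card (F n)) sequentially"
      using diverges by (simp add: filterlim_at_top)
    then obtain n' where n': "n' > n" "(\<Sum>i\<in>F n'. (w n' i)\<^sup>2) \<ge> L\<^sup>2 + card (F n)"
      using eventually_happens'[OF _ eventually_conj[OF _ eventually_gt_at_top[of n]]] by force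
    have "F n \<subseteq> F n'" using F(3) n'(1) by (simp add: monoD)
    then have "(\<Sum>i\<in>F n'. (w n' i)\<^sup>2) = (\<Sum>i\<in>F n' - F n. (w n' i)\<^sup>2) + (\<Sum>i\<in>F n. (w n' i)\<^sup>2)"
      by (rule sum.subset_diff) (rule F)
    moreover have "(\<Sum>i\<in>F n. (w n' i)\<^sup>2) \<le> (\<Sum>i\<in>F n. 1)"
      using w by (intro sum_mono) (simp add: abs_square_le_1)
    ultimately have "L\<^sup>2 \<le> (\<Sum>i\<in>F n' - F n. (w n' i)\<^sup>2)"
      using n' by simp
    then have "L \<le> b n n'"
      unfolding b_def by (rule real_le_rsqrt)
    then show ?thesis using n'(1) unfolding L_def by blast
  qed
  then have "\<forall>n k. \<exists>n'. n' > n \<and> b n n' \<ge> 2 ^ k * (real (card (F n)) + 1)" by blast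
  then obtain g where g: "\<forall>n k. g n k > n \<and> b n (g n k) \<ge> 2 ^ k * (real (card (F n)) + 1)"
    by (auto simp: choice_iff)
  define r where "r = rec_nat 0 (\<lambda>k n. g n k)"
  have r_Suc: "r (Suc k) = g (r k) k" for k
    by (simp add: r_def)
  define J where "J k = F (r (Suc k)) - F (r k)" for k
  define B where "B k = sqrt (\<Sum>i\<in>J k. (w (r (Suc k)) i)\<^sup>2)" for k
  have B_ge: "B k \<ge> 2 ^ k * (real (card (F (r k))) + 1)" for k
    using g by (simp add: B_def b_def J_def r_Suc)
  have B_ge2: "B k \<ge> 2 ^ k" for k
    using B_ge[of k] by (smt (verit) mult_le_cancel_left1 of_nat_0_le_iff zero_less_power)
  have r_mono: "strict_mono r"
    by (rule strict_monoI_Suc) (simp add: r_Suc g)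
  have J_disj: "disjoint_family J"
  proof -
    have "J j \<inter> J k = {}" if "j < k" for j k
    proof -
      have "F (r (Suc j)) \<subseteq> F (r k)"
        using that r_mono F(3) by (simp add: monoD strict_mono_less_eq)
      then show ?thesis by (auto simp: J_def)
    qed
    then show ?thesis
      unfolding disjoint_family_on_def by (metis Int_commute linorder_neqE_nat)
  qed
  have J: "J k \<subseteq> I" "finite (J k)" for k
    using F by (auto simp: J_def)
  define Y where "Y k \<omega> = (\<Sum>i\<in>J k. w (r (Suc k)) i * X i \<omega>)" for k \<omega>
  define Q where "Q k \<omega> = (\<Sum>i\<in>F (r k). \<bar>X i \<omega>\<bar>)" for k \<omega>
  have Q_meas[measurable]: "Q k \<in> borel_measurable M" for k
    unfolding Q_def by measurable
  have "real k \<le> B k" for k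
    using B_ge2[of k] of_nat_less_two_power[of k, where 'a=real] by linarith
  then have B_top: "filterlim B at_top sequentially"
    by (intro filterlim_at_top_mono[OF filterlim_real_sequentially] always_eventually) simp

  have often: "AE \<omega> in M. infinite {k. Y k \<omega> > s * B k}"
  proof -
    have "filterlim (\<lambda>k. (B k)\<^sup>2) at_top sequentially"
      by (intro filterlim_pow_at_top B_top) simp
    then have diverges_J: "filterlim (\<lambda>k. \<Sum>i\<in>J k. (w (r (Suc k)) i)\<^sup>2) at_top sequentially"
      by (simp add: B_def sum_nonneg)
    obtain \<delta> where \<delta>: "\<delta> > 0" "eventually (\<lambda>k. prob {\<omega>\<in>space M. Y k \<omega> > s * B k} \<ge> \<delta>) sequentially"
      unfolding Y_def B_def
      by (rule weighted_sum_exceeds_deviation[where J=J and w="\<lambda>k. w (r (Suc k))",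
            OF indep distr \<mu> square_integrable mean variance s J w diverges_J])
    have "indep_vars (\<lambda>k. PiM (J k) (\<lambda>_. borel)) (\<lambda>k \<omega>. restrict (\<lambda>i. X i \<omega>) (J k)) UNIV"
      using J J_disj by (intro indep_vars_restrict[OF indep]) auto
    then have "indep_vars (\<lambda>_. borel) (\<lambda>k \<omega>. \<Sum>i\<in>J k. w (r (Suc k)) i * restrict (\<lambda>i. X i \<omega>) (J k) i) UNIV"
      by (rule indep_vars_compose2[where Y="\<lambda>k f. \<Sum>i\<in>J k. w (r (Suc k)) i * f i"]) measurable
    then have "indep_vars (\<lambda>_. borel) Y UNIV"
      by (rule indep_vars_cong[THEN iffD1, rotated 3]) (auto simp: Y_def fun_eq_iff)
    then have "indep_events (\<lambda>k. {\<omega>\<in>space M. Y k \<omega> > s * B k}) UNIV"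
      by (rule indep_eventsI_indep_vars) measurable
    then show ?thesis
      using \<delta> by (rule infinitely_often_if_indep_and_prob_bounded_below)
  qed

  have rare: "AE \<omega> in M. eventually (\<lambda>k. Q k \<omega> < s * B k / 2) sequentially"
  proof -
    define m where "m = integral\<^sup>L \<mu> abs"
    have X_int: "integrable M (X i)" and X_abs: "(\<integral>\<omega>. \<bar>X i \<omega>\<bar> \<partial>M) = m" if "i \<in> I" for i
      using \<mu>_integrable rv[OF that] unfolding m_def distr[OF that, symmetric]
      by (simp_all add: integrable_distr_eq integral_distr)
    have m_nonneg: "m \<ge> 0" unfolding m_def by simp
    have Q_int: "integrable M (Q k)" for k
      unfolding Q_def using F X_int by (intro Bochner_Integration.integrable_sum integrable_abs) auto
    have Q_exp: "expectation (Q k) = card (F (r k)) * m" for k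
    proof -
      have "expectation (Q k) = (\<Sum>i\<in>F (r k). \<integral>\<omega>. \<bar>X i \<omega>\<bar> \<partial>M)"
        unfolding Q_def using F X_int by (intro Bochner_Integration.integral_sum integrable_abs) auto
      also have "\<dots> = (\<Sum>i\<in>F (r k). m)"
        using F X_abs by (intro sum.cong) auto
      finally show ?thesis by simp
    qed
    have prob_le: "prob {\<omega>\<in>space M. Q k \<omega> \<ge> s * B k / 2} \<le> 2 * m / s * (1 / 2) ^ k" for k
    proof -
      have Bpos: "B k > 0" using B_ge2[of k] by (smt (verit) zero_less_power)
      have "prob {\<omega>\<in>space M. Q k \<omega> \<ge> s * B k / 2} \<le> expectation (Q k) / (s * B k / 2)"
        using s Bpos by (intro integral_Markov_inequality_measure[where A="{}", simplified] Q_int AE_I2)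
          (auto simp: Q_def sum_nonneg)
      also have "\<dots> = 2 * m / s * (card (F (r k)) / B k)"
        by (simp add: Q_exp)
      also have "\<dots> \<le> 2 * m / s * (1 / 2) ^ k"
      proof (intro mult_left_mono)
        have "2 ^ k * real (card (F (r k))) \<le> B k"
          using B_ge[of k] by (simp add: algebra_simps) (smt (verit) zero_less_power)
        then show "card (F (r k)) / B k \<le> (1 / 2) ^ k"
          using Bpos by (simp add: field_simps)
      qed (use s m_nonneg in simp)
      finally show ?thesis .
    qed
    have "AE \<omega> in M. eventually (\<lambda>k. \<omega> \<in> space M - {\<omega>\<in>space M. Q k \<omega> \<ge> s * B k / 2}) sequentially"
    proof (rule borel_cantelli_AE1)
      show "summable (\<lambda>k. prob {\<omega>\<in>space M. Q k \<omega> \<ge> s * B k / 2})"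
      proof (rule summable_comparison_test'[where N=0])
        show "summable (\<lambda>k. 2 * m / s * (1 / 2) ^ k)"
          by (intro summable_mult summable_geometric) simp
        show "norm (prob {\<omega>\<in>space M. Q k \<omega> \<ge> s * B k / 2}) \<le> 2 * m / s * (1 / 2) ^ k" for k
          using prob_le[of k] by (simp only: real_norm_def abs_of_nonneg measure_nonneg)
      qed
    qed (auto simp: emeasure_eq_measure)
    then show ?thesis
      by eventually_elim (auto elim!: eventually_mono)
  qed

  show ?thesis
    using often rare
  proof eventually_elim
    case (elim \<omega>)
    show ?case
    proof
      fix K
      have "eventually (\<lambda>k. Q k \<omega> < s * B k / 2 \<and> s * B k / 2 \<ge> K) sequentially"
      proof (rule eventually_conj[OF elim(2)])
        have "filterlim (\<lambda>k. s / 2 * B k) at_top sequentially"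
          using s by (intro filterlim_tendsto_pos_mult_at_top[OF tendsto_const] B_top) auto
        then show "eventually (\<lambda>k. s * B k / 2 \<ge> K) sequentially"
          by (simp add: filterlim_at_top)
      qed
      moreover have "frequently (\<lambda>k. Y k \<omega> > s * B k) sequentially"
        using elim(1) by (simp add: frequently_cofinite cofinite_eq_sequentially[symmetric])
      ultimately have "\<exists>k. Y k \<omega> > s * B k \<and> Q k \<omega> < s * B k / 2 \<and> s * B k / 2 \<ge> K"
        by (intro frequently_ex[OF frequently_eventually_frequently])
      then obtain k where k: "Q k \<omega> < s * B k / 2" "s * B k / 2 \<ge> K" "Y k \<omega> > s * B k"
        by blast
      let ?n = "r (Suc k)"
      have "F (r k) \<subseteq> F ?n"
        using r_mono F(3) by (simp add: monoD strict_mono_less_eq)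
      then have "(\<Sum>i\<in>F ?n. w ?n i * X i \<omega>) = Y k \<omega> + (\<Sum>i\<in>F (r k). w ?n i * X i \<omega>)"
        unfolding Y_def J_def by (rule sum.subset_diff) (rule F)
      moreover have "\<bar>\<Sum>i\<in>F (r k). w ?n i * X i \<omega>\<bar> \<le> Q k \<omega>"
        unfolding Q_def using w
        by (intro order_trans[OF sum_abs] sum_mono) (simp add: abs_mult mult_left_le_one_le)
      ultimately have "(\<Sum>i\<in>F ?n. w ?n i * X i \<omega>) \<ge> K"
        using k by linarith
      then show "\<exists>n. (\<Sum>i\<in>F n. w n i * X i \<omega>) \<ge> K" ..
    qed
  qed
qed

end

section \<open>Non-stabilization\<close>

lemma odometer_incseq: "incseq (\<lambda>n. odometer n \<sigma> x)"
proof (rule incseq_SucI)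
  fix n
  obtain xs ys where "stabilizing_topplings n \<sigma> xs" "stabilizing_topplings (Suc n) \<sigma> ys"
    using ex_stabilizing_topplings by metis
  then show "odometer n \<sigma> x \<le> odometer (Suc n) \<sigma> x"
    by (intro odometer_mono SG_level_mono) simp_all
qed

lemma origin_in_SG_level: "0 \<in> SG_level n"
  by (simp add: SG_level_def)

text \<open>Monotonicity in the level matters here: without convergence, \<^const>\<open>odometer_limit\<close> would be an
unspecified value.\<close>

lemma not_stabilizable_if_odometer_unbounded:
  assumes unbounded: "\<And>K. \<exists>n. K \<le> real (odometer n \<sigma> 0)"
  shows "\<not> stabilizable \<sigma>"
proof -
  let ?u = "\<lambda>n. of_nat (odometer n \<sigma> 0) :: ennreal"
  have "incseq ?u"
    using odometer_incseq[of \<sigma> 0] by (simp add: incseq_def)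
  then have limit: "odometer_limit \<sigma> 0 = (SUP n. ?u n)"
    unfolding odometer_limit_def by (intro limI LIMSEQ_SUP)
  have "of_nat k \<le> odometer_limit \<sigma> 0" for k :: nat
  proof -
    obtain n where "real k \<le> real (odometer n \<sigma> 0)"
      using unbounded by blast
    then have "of_nat k \<le> ?u n" by simp
    then show ?thesis
      unfolding limit by (rule SUP_upper2[OF UNIV_I])
  qed
  then have "\<not> odometer_limit \<sigma> 0 < \<infinity>"
    by (metis ennreal_Ex_less_of_nat infinity_ennreal_def linorder_not_less)
  moreover have "0 \<in> SG"
    using origin_in_SG_level by (auto simp: SG_def)
  ultimately show ?thesis
    unfolding stabilizable_def by blast
qed

lemma green_square_sum_diverges: "filterlim (\<lambda>n. \<Sum>x\<in>SG_level n. (green n x)\<^sup>2) at_top sequentially"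
proof -
  have bound: "4 / 25 * real n \<le> (\<Sum>x\<in>SG_level (Suc n). (green (Suc n) x)\<^sup>2)" for n
  proof -
    have "4 / 25 * real n \<le> (\<Sum>x\<in>SG_level n. (2 / 5)\<^sup>2)"
      using card_SG_level[of n] by (simp add: power2_eq_square)
    also have "\<dots> \<le> (\<Sum>x\<in>SG_level n. (green (Suc n) x)\<^sup>2)"
      using green_ge_inner by (intro sum_mono power_mono) auto
    also have "\<dots> \<le> (\<Sum>x\<in>SG_level (Suc n). (green (Suc n) x)\<^sup>2)"
      using SG_level_mono[of n "Suc n"] by (intro sum_mono2) auto
    finally show ?thesis .
  qed
  have "filterlim (\<lambda>n. 4 / 25 * real n) at_top sequentially"
    by (intro filterlim_tendsto_pos_mult_at_top[OF tendsto_const _ filterlim_real_sequentially]) simp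
  then have "filterlim (\<lambda>n. \<Sum>x\<in>SG_level (Suc n). (green (Suc n) x)\<^sup>2) at_top sequentially"
    by (rule filterlim_at_top_mono) (simp only: bound eventually_True)
  then show ?thesis
    by (rule filterlim_sequentially_Suc[THEN iffD1])
qed

theorem theorem1p2:
  fixes M :: "'a measure" and \<sigma> :: "point \<Rightarrow> 'a \<Rightarrow> nat"
  assumes prob: "prob_space M"
    and indep: "prob_space.indep_vars M (\<lambda>_. count_space UNIV) \<sigma> SG"
    and ident: "\<And>x. x \<in> SG \<Longrightarrow>
      distr M (count_space UNIV) (\<sigma> x) = distr M (count_space UNIV) (\<sigma> (0, 0))"
    and integrable_mean: "integrable M (\<lambda>\<omega>. real (\<sigma> (0, 0) \<omega>))"
    and mean: "prob_space.expectation M (\<lambda>\<omega>. real (\<sigma> (0, 0) \<omega>)) \<ge> 3"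
    and finite_variance: "integrable M (\<lambda>\<omega>. (real (\<sigma> (0, 0) \<omega>)
      - prob_space.expectation M (\<lambda>\<omega>. real (\<sigma> (0, 0) \<omega>)))\<^sup>2)"
    and positive_variance: "prob_space.variance M (\<lambda>\<omega>. real (\<sigma> (0, 0) \<omega>)) > 0"
  shows "AE \<omega> in M. \<not> stabilizable (\<lambda>x. \<sigma> x \<omega>)"
proof -
  interpret prob_space M by fact
  define m where "m = expectation (\<lambda>\<omega>. real (\<sigma> (0, 0) \<omega>))"
  define X where "X x \<omega> = real (\<sigma> x \<omega>) - m" for x \<omega>
  define \<mu> where "\<mu> = distr M borel (X (0, 0))"
  define s where "s = sqrt (expectation (\<lambda>\<omega>. (X (0, 0) \<omega>)\<^sup>2))"
  have origin: "(0, 0) \<in> SG"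
    using origin_in_SG_level by (auto simp: SG_def zero_prod_def)
  have \<sigma>_rv: "\<sigma> x \<in> M \<rightarrow>\<^sub>M count_space UNIV" if "x \<in> SG" for x
    using indep that unfolding indep_vars_def2 by blast
  have X_indep: "indep_vars (\<lambda>_. borel) X SG"
    unfolding X_def by (rule indep_vars_compose2[OF indep, where Y="\<lambda>_ k. real k - m"]) simp
  have X_rv [measurable]: "X (0, 0) \<in> borel_measurable M"
    using X_indep origin unfolding indep_vars_def2 by blast
  have X_distr: "distr M borel (X x) = \<mu>" if "x \<in> SG" for x
  proof -
    have eq: "distr M borel (X y) = distr (distr M (count_space UNIV) (\<sigma> y)) borel (\<lambda>k. real k - m)"
      if "y \<in> SG" for y
      using \<sigma>_rv[OF that] by (simp add: distr_distr X_def[abs_def] comp_def)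
    show ?thesis
      unfolding \<mu>_def eq[OF that] eq[OF origin] ident[OF that] ..
  qed
  \<comment> \<open>The mean may exceed 3; centring at the mean instead of 3 only decreases the sum, since the
    weights are nonnegative.\<close>
  have "AE \<omega> in M. \<forall>K. \<exists>n. (\<Sum>x\<in>SG_level n. green n x * X x \<omega>) \<ge> K"
  proof (rule weighted_sums_unbounded[OF X_indep X_distr])
    show "real_distribution \<mu>"
      unfolding \<mu>_def by (rule real_distribution_distr) (rule X_rv)
    show "integrable \<mu> (\<lambda>x. x\<^sup>2)"
      using finite_variance by (simp add: \<mu>_def integrable_distr_eq X_def m_def)
    show "integral\<^sup>L \<mu> (\<lambda>x. x) = 0"
      using integrable_mean by (simp add: \<mu>_def integral_distr X_def prob_space m_def)
    show "integral\<^sup>L \<mu> (\<lambda>x. x\<^sup>2) = s\<^sup>2"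
      by (simp add: \<mu>_def integral_distr s_def)
    show "s > 0"
      using positive_variance by (simp add: s_def X_def m_def)
    show "mono SG_level"
      by (intro monoI SG_level_mono)
    show "SG_level n \<subseteq> SG" for n
      by (auto simp: SG_def)
    show "\<bar>green n x\<bar> \<le> 1" for n x
      using green_bounds[of n x] by simp
  qed (simp_all add: green_square_sum_diverges)
  then show ?thesis
  proof eventually_elim
    case (elim \<omega>)
    have "\<exists>n. K \<le> real (odometer n (\<lambda>x. \<sigma> x \<omega>) 0)" for K
    proof -
      obtain n where n: "(\<Sum>x\<in>SG_level n. green n x * X x \<omega>) \<ge> K"
        using elim by blast
      also have "(\<Sum>x\<in>SG_level n. green n x * X x \<omega>) \<le> (\<Sum>x\<in>SG_level n. green n x * (real (\<sigma> x \<omega>) - 3))"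
        using mean green_bounds by (intro sum_mono mult_left_mono) (auto simp: X_def m_def)
      also have "\<dots> \<le> (3 / 5) ^ n * odometer n (\<lambda>x. \<sigma> x \<omega>) 0"
        by (rule odometer_origin_ge)
      also have "\<dots> \<le> 1 * real (odometer n (\<lambda>x. \<sigma> x \<omega>) 0)"
        by (intro mult_right_mono) (simp_all add: power_le_one)
      finally show ?thesis by auto
    qed
    then show ?case
      by (rule not_stabilizable_if_odometer_unbounded)
  qed
qed

end
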